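(* Let $A_1,\dots,A_m$ be $n\times n$ complex positive definite matrices and let $w=(w_1,\dots,w_m)$ be a vector of weights, i.e. $w_j\ge 0$ and $\sum_{j=1}^m w_j=1$. Let $G=G(w;A_1,\dots,A_m)$, $L=L(w;A_1,\dots,A_m)$ and $\Omega=\Omega(w;A_1,\dots,A_m)$ be respectively the weighted Cartan mean, the weighted log Euclidean mean and the weighted Wasserstein mean of $A_1,\dots,A_m$. Then $$\lambda(G)\underset{\log}{\prec}\lambda(L)\underset{w\log}{\prec}\lambda(\Omega),$$ that is, $\lambda(G)$ is log majorised by $\lambda(L)$, and $\lambda(L)$ is weakly log majorised by $\lambda(\Omega)$.
   Context: $\mathbb{P}$ denotes the space of $n\times n$ complex positive definite matrices; for $A\in\mathbb{P}$ and real $p$, $A^{p}$ and $\log A$ are defined by the functional calculus. $\|X\|_2=(\mathrm{tr}\,X^*X)^{1/2}$ is the Frobenius norm. Cartan mean: $G(w;A_1,\dots,A_m)$ is the unique minimizer over $X\in\mathbb{P}$ of $\sum_{j=1}^m w_j\,\delta^2(X,A_j)$, where $\delta(A,B)=\|\log(A^{-1/2}BA^{-1/2})\|_2$. Equivalently, it is the unique positive definite solution $X$ of $\sum_{j=1}^m w_j\log(X^{-1/2}A_jX^{-1/2})=0$. Log Euclidean mean: $L(w;A_1,\dots,A_m)=\exp\left(\sum_{j=1}^m w_j\log A_j\right)$. Wasserstein mean: $\Omega(w;A_1,\dots,A_m)$ is the unique minimizer over $X\in\mathbb{P}$ of $\sum_{j=1}^m w_j\,d^2(X,A_j)$, where $d(A,B)=\left[\mathrm{tr}(A+B)-2\,\mathrm{tr}\,(A^{1/2}BA^{1/2})^{1/2}\right]^{1/2}$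 is the Bures-Wasserstein distance. Equivalently, it is the unique positive definite solution $X$ of $X=\sum_{j=1}^m w_j(X^{1/2}A_jX^{1/2})^{1/2}$. $\lambda(A)$ denotes the $n$-tuple of eigenvalues of $A$ (counted with multiplicity). For $n$-tuples $x,y$ of nonnegative numbers, let $x_1^{\downarrow}\ge\dots\ge x_n^{\downarrow}$ be the decreasing rearrangement of $x$, and similarly for $y$. We write $x\underset{w\log}{\prec}y$ ($x$ is weakly log majorised by $y$) if $\prod_{j=1}^k x_j^{\downarrow}\le\prod_{j=1}^k y_j^{\downarrow}$ for all $1\le k\le n$; and $x\underset{\log}{\prec}y$ ($x$ is log majorised by $y$) if in addition $\prod_{j=1}^n x_j^{\downarrow}=\prod_{j=1}^n y_j^{\downarrow}$. *)

theory Defs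
  imports "HOL-Analysis.Analysis" "HOL-Computational_Algebra.Polynomial"
begin

definition ctranspose :: "complex^'n^'m \<Rightarrow> complex^'m^'n" where
  "ctranspose A = (\<chi> i j. cnj (A $ j $ i))"

definition hermitian :: "complex^'n^'n \<Rightarrow> bool" where
  "hermitian A \<longleftrightarrow> ctranspose A = A"

definition unitary :: "complex^'n^'n \<Rightarrow> bool" where
  "unitary U \<longleftrightarrow> ctranspose U ** U = mat 1 \<and> U ** ctranspose U = mat 1"

(* For Hermitian A the quadratic form is real-valued, so Re only changes the type. *)
definition posdef :: "complex^'n^'n \<Rightarrow> bool" where
  "posdef A \<longleftrightarrow> hermitian A \<and>
     (\<forall>x. x \<noteq> 0 \<longrightarrow> 0 < Re (\<Sum>i\<in>UNIV. cnj (x $ i) * (A *v x) $ i))"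

definition diag_mat :: "('n \<Rightarrow> real) \<Rightarrow> complex^'n^'n" where
  "diag_mat d = (\<chi> i j. if i = j then complex_of_real (d i) else 0)"

(* Functional calculus for Hermitian matrices.  By fun_calc_eq below, the matrix described
   does not depend on the unitary diagonalization chosen. *)
definition fun_calc :: "(real \<Rightarrow> real) \<Rightarrow> complex^'n^'n \<Rightarrow> complex^'n^'n" where
  "fun_calc f A = (THE B. \<exists>U d. unitary U \<and>
      A = U ** diag_mat d ** ctranspose U \<and>
      B = U ** diag_mat (\<lambda>i. f (d i)) ** ctranspose U)"

definition mat_powr :: "complex^'n^'n \<Rightarrow> real \<Rightarrow> complex^'n^'n" where
  "mat_powr A p = fun_calc (\<lambda>t. t powr p) A"

definition mat_log :: "complex^'n^'n \<Rightarrow> complex^'n^'n" where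
  "mat_log A = fun_calc ln A"

definition mat_exp :: "complex^'n^'n \<Rightarrow> complex^'n^'n" where
  "mat_exp A = fun_calc exp A"

lemma diag_mat_mult_left: "(diag_mat d ** M) $ i $ j = complex_of_real (d i) * M $ i $ j"
  unfolding diag_mat_def matrix_matrix_mult_def
  by (simp add: if_distrib[where f = "\<lambda>x. x * _"] cong: if_cong)

lemma diag_mat_mult_right: "(M ** diag_mat d) $ i $ j = M $ i $ j * complex_of_real (d j)"
  unfolding diag_mat_def matrix_matrix_mult_def
  by (simp add: if_distrib[where f = "\<lambda>x. _ * x"] cong: if_cong)

lemma fun_calc_unique:
  assumes U: "unitary U" and V: "unitary V"
    and eq: "U ** diag_mat d ** ctranspose U = V ** diag_mat e ** ctranspose V"
  shows "U ** diag_mat (\<lambda>i. f (d i)) ** ctranspose U =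
         V ** diag_mat (\<lambda>i. f (e i)) ** ctranspose V"
proof -
  define W where "W = ctranspose V ** U"
  have u: "ctranspose U ** U = mat 1" "U ** ctranspose U = mat 1"
    and v: "ctranspose V ** V = mat 1" "V ** ctranspose V = mat 1"
    using U V by (auto simp: unitary_def)
  have UW: "U = V ** W"
    by (simp add: W_def matrix_mul_assoc v)
  have "W ** diag_mat d = ctranspose V ** (U ** diag_mat d ** ctranspose U) ** U"
    by (simp add: W_def matrix_mul_assoc[symmetric] u)
  also have "\<dots> = (ctranspose V ** V) ** diag_mat e ** (ctranspose V ** U)"
    unfolding eq by (simp only: matrix_mul_assoc)
  also have "\<dots> = diag_mat e ** W"
    by (simp add: v W_def)
  finally have comm: "W ** diag_mat d = diag_mat e ** W" .
  have "(W ** diag_mat (\<lambda>i. f (d i))) $ i $ j = (diag_mat (\<lambda>i. f (e i)) ** W) $ i $ j" for i j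
  proof -
    have "W $ i $ j * complex_of_real (d j) = complex_of_real (e i) * W $ i $ j"
      using comm by (metis diag_mat_mult_left diag_mat_mult_right)
    then have "W $ i $ j = 0 \<or> d j = e i" by auto
    then show ?thesis by (auto simp: diag_mat_mult_left diag_mat_mult_right)
  qed
  then have comm': "W ** diag_mat (\<lambda>i. f (d i)) = diag_mat (\<lambda>i. f (e i)) ** W"
    by (simp add: vec_eq_iff)
  have "U ** diag_mat (\<lambda>i. f (d i)) ** ctranspose U =
        V ** (W ** diag_mat (\<lambda>i. f (d i))) ** ctranspose U"
    by (simp add: UW matrix_mul_assoc)
  also have "\<dots> = V ** diag_mat (\<lambda>i. f (e i)) ** (W ** ctranspose U)"
    unfolding comm' by (simp only: matrix_mul_assoc)
  also have "W ** ctranspose U = ctranspose V"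
    by (simp add: W_def matrix_mul_assoc[symmetric] u)
  finally show ?thesis .
qed

lemma fun_calc_eq:
  assumes "unitary U"
  shows "fun_calc f (U ** diag_mat d ** ctranspose U) =
         U ** diag_mat (\<lambda>i. f (d i)) ** ctranspose U"
  unfolding fun_calc_def
proof (rule the_equality)
  show "\<exists>V e. unitary V \<and>
      U ** diag_mat d ** ctranspose U = V ** diag_mat e ** ctranspose V \<and>
      U ** diag_mat (\<lambda>i. f (d i)) ** ctranspose U =
      V ** diag_mat (\<lambda>i. f (e i)) ** ctranspose V"
    using assms by (intro exI[of _ U] exI[of _ d]) (rule conjI, assumption, rule conjI, rule refl, rule refl)
next
  fix B
  assume "\<exists>V e. unitary V \<and>
      U ** diag_mat d ** ctranspose U = V ** diag_mat e ** ctranspose V \<and>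
      B = V ** diag_mat (\<lambda>i. f (e i)) ** ctranspose V"
  then obtain V e where V: "unitary V"
    and eq: "U ** diag_mat d ** ctranspose U = V ** diag_mat e ** ctranspose V"
    and B: "B = V ** diag_mat (\<lambda>i. f (e i)) ** ctranspose V"
    by (elim exE conjE)
  show "B = U ** diag_mat (\<lambda>i. f (d i)) ** ctranspose U"
    unfolding B by (rule fun_calc_unique[OF assms V eq, symmetric])
qed

definition frob_norm :: "complex^'n^'n \<Rightarrow> real" where
  "frob_norm X = sqrt (Re (trace (ctranspose X ** X)))"

definition cartan_dist :: "complex^'n^'n \<Rightarrow> complex^'n^'n \<Rightarrow> real" where
  "cartan_dist A B =
     frob_norm (mat_log (mat_powr A (- 1 / 2) ** B ** mat_powr A (- 1 / 2)))"

definition bw_dist :: "complex^'n^'n \<Rightarrow> complex^'n^'n \<Rightarrow> real" where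
  "bw_dist A B = sqrt (Re (trace (A + B) -
     2 * trace (mat_powr (mat_powr A (1 / 2) ** B ** mat_powr A (1 / 2)) (1 / 2))))"

(* In both cases the minimizer over the positive definite matrices exists and is unique
   for positive definite A 1, ..., A m and weights w, so arg_min denotes it. *)
definition cartan_mean ::
  "nat \<Rightarrow> (nat \<Rightarrow> real) \<Rightarrow> (nat \<Rightarrow> complex^'n^'n) \<Rightarrow> complex^'n^'n" where
  "cartan_mean m w A = arg_min (\<lambda>X. \<Sum>j = 1..m. w j * (cartan_dist X (A j))\<^sup>2) posdef"

definition wasserstein_mean ::
  "nat \<Rightarrow> (nat \<Rightarrow> real) \<Rightarrow> (nat \<Rightarrow> complex^'n^'n) \<Rightarrow> complex^'n^'n" where
  "wasserstein_mean m w A = arg_min (\<lambda>X. \<Sum>j = 1..m. w j * (bw_dist X (A j))\<^sup>2) posdef"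

definition log_euclidean_mean ::
  "nat \<Rightarrow> (nat \<Rightarrow> real) \<Rightarrow> (nat \<Rightarrow> complex^'n^'n) \<Rightarrow> complex^'n^'n" where
  "log_euclidean_mean m w A = mat_exp (\<Sum>j = 1..m. w j *\<^sub>R mat_log (A j))"

definition charpoly :: "complex^'n^'n \<Rightarrow> complex poly" where
  "charpoly A = det (\<chi> i j. (if i = j then [:0, 1:] else 0) - [:A $ i $ j:])"

(* The eigenvalues with algebraic multiplicity, for matrices with real spectrum
   (as Hermitian matrices have); the order of the list plays no role below. *)
definition eigvals :: "complex^'n^'n \<Rightarrow> real list" where
  "eigvals A = sorted_list_of_multiset (image_mset Re (proots (charpoly A)))"

definition decr_rearr :: "real list \<Rightarrow> real list" where
  "decr_rearr x = rev (sort x)"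

definition wlog_majorized :: "real list \<Rightarrow> real list \<Rightarrow> bool"  (infix "\<prec>wlog" 50) where
  "x \<prec>wlog y \<longleftrightarrow> length x = length y \<and>
     (\<forall>k\<in>{1..length x}. prod_list (take k (decr_rearr x)) \<le> prod_list (take k (decr_rearr y)))"

definition log_majorized :: "real list \<Rightarrow> real list \<Rightarrow> bool"  (infix "\<prec>log" 50) where
  "x \<prec>log y \<longleftrightarrow> x \<prec>wlog y \<and> prod_list (decr_rearr x) = prod_list (decr_rearr y)"

end

(* Majorization. For k orthonormal vectors u_1, ..., u_k, Ky Fan's principle bounds the sum of the
   <u_i, H u_i> with H = sum_j w_j log A_j by the sum of the k largest eigenvalues of H = log L. It
   is therefore enough to compare such sums, and no antisymmetric tensor powers are needed. The
   analytic input is that v.(log B)v <= v.(log M)v whenever C is a contraction with C* v = v and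
   C* B C <= M; this follows from the same inequality for the resolvents, log being an integral of
   resolvents. Statements about the k leading eigenvectors are obtained by splitting the spectrum at
   the k-th eigenvalue into a contraction and an expansion, and by passing from the orthogonal
   complement back with the determinant.

   The equations behind it. G satisfies sum_j w_j log(G^(-1/2) A_j G^(-1/2)) = 0: the objective is
   coercive, so a minimizer exists, and the equation is its stationarity in the variable
   Y = X^(-1/2). For Omega, Brouwer's theorem gives a fixed point X = sum_j w_j
   (X^(1/2) A_j X^(1/2))^(1/2), equivalently sum_j w_j T_j = I for the solutions T_j of T_j X T_j = A_j,
   and completing a square shows that it is the only minimizer. *)
theory Submission
  imports Defs "HOL-Real_Asymp.Real_Asymp"
begin

section \<open>Hermitian matrices and the real inner product\<close>

text \<open>Why the variable Y: in terms of X the Cartan objective contains X^(-1/2), in terms of Y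
  only the congruence Y A Y, which is polynomial in Y. So no matrix square root has to be
  differentiated. Why the spectrum is cut: when G has eigenvalues on both sides of 1, a congruence
  by G^(1/2) neither increases nor decreases quadratic forms. Dividing by c costs only ln c times
  the identity in the logarithm, and each of the two remaining factors fixes one of two
  complementary groups of eigenvectors. An expansion gives a bound only on the group that it fixes,
  which is the wrong one; since log det is known exactly, an upper bound there becomes a lower bound
  on the other group. Why one majorization is strict about determinants and the other is weak: sum
  w_j log(G^(-1/2) A_j G^(-1/2)) = 0 enters as an equation between logarithms, so its trace equates
  the determinants. The equation sum w_j T_j = I can enter only through ln t <= t - 1, and there
  equality is lost.\<close>

lemma ctranspose_nth [simp]: "ctranspose A $ i $ j = cnj (A $ j $ i)"
  by (simp add: ctranspose_def)

lemma ctranspose_ctranspose [simp]: "ctranspose (ctranspose A) = A"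
  by (simp add: vec_eq_iff)

lemma ctranspose_mult: "ctranspose (A ** B) = ctranspose B ** ctranspose A"
  by (simp add: vec_eq_iff matrix_matrix_mult_def mult.commute)

lemma ctranspose_add: "ctranspose (A + B) = ctranspose A + ctranspose B"
  and ctranspose_diff: "ctranspose (A - B) = ctranspose A - ctranspose B"
  and ctranspose_scaleR: "ctranspose (c *\<^sub>R A) = c *\<^sub>R ctranspose A"
  by (simp_all add: vec_eq_iff)

lemma ctranspose_sum: "ctranspose (\<Sum>i\<in>I. f i) = (\<Sum>i\<in>I. ctranspose (f i))"
  by (induction I rule: infinite_finite_induct) (auto simp: ctranspose_add vec_eq_iff)

lemma ctranspose_mat_1 [simp]: "ctranspose (mat 1) = mat 1"
  by (simp add: vec_eq_iff mat_def)

lemma ctranspose_diag_mat [simp]: "ctranspose (diag_mat d) = diag_mat d"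
  by (simp add: vec_eq_iff diag_mat_def)

lemma mat_mult_scaleR_left: "(c *\<^sub>R A) ** B = c *\<^sub>R (A ** B)" for A :: "complex^'n^'m"
  by (simp add: vec_eq_iff matrix_matrix_mult_def scaleR_sum_right)

lemma mat_mult_scaleR_right: "A ** (c *\<^sub>R B) = c *\<^sub>R (A ** B)" for A :: "complex^'n^'m"
  by (simp add: vec_eq_iff matrix_matrix_mult_def scaleR_sum_right)

lemma mat_mult_vec_scaleR: "(c *\<^sub>R A) *v x = c *\<^sub>R (A *v x)" for A :: "complex^'n^'m"
  by (simp add: vec_eq_iff matrix_vector_mult_def scaleR_sum_right)

lemma mat_mult_add_right: "(A + B) ** C = A ** C + B ** C" for A :: "complex^'n^'m"
  by (simp add: vec_eq_iff matrix_matrix_mult_def algebra_simps sum.distrib)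

lemma mat_mult_diff_right: "(A - B) ** C = A ** C - B ** C" for A :: "complex^'n^'m"
  by (simp add: vec_eq_iff matrix_matrix_mult_def algebra_simps sum_subtractf)

lemma mat_mult_diff_left: "C ** (A - B) = C ** A - C ** B" for A :: "complex^'n^'m"
  by (simp add: vec_eq_iff matrix_matrix_mult_def algebra_simps sum_subtractf)

lemma mat_mult_0 [simp]: "(0 :: complex^'n^'m) ** C = 0" "C ** (0 :: complex^'n^'m) = 0"
  by (simp_all add: vec_eq_iff matrix_matrix_mult_def)

lemma mat_vec_mult_scaleR: "A *v (c *\<^sub>R x) = c *\<^sub>R (A *v x)" for A :: "complex^'n^'m"
  by (simp add: vec_eq_iff matrix_vector_mult_def scaleR_sum_right)

lemma mat_mult_sum_right: "(\<Sum>i\<in>I. f i) ** C = (\<Sum>i\<in>I. f i ** C)"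
  for f :: "'i \<Rightarrow> complex^'n^'m"
  by (induction I rule: infinite_finite_induct) (auto simp: mat_mult_add_right)

lemma mat_mult_sum_left: "C ** (\<Sum>i\<in>I. f i) = (\<Sum>i\<in>I. C ** f i)"
  for f :: "'i \<Rightarrow> complex^'n^'m"
  by (induction I rule: infinite_finite_induct) (auto simp: matrix_add_ldistrib)

lemma sum_mat_mult_vec: "(\<Sum>i\<in>I. f i) *v x = (\<Sum>i\<in>I. f i *v x)"
  for f :: "'i \<Rightarrow> complex^'n^'m"
  by (induction I rule: infinite_finite_induct) (auto simp: matrix_vector_mult_add_rdistrib)

lemmas mat_distribs = mat_mult_scaleR_left mat_mult_scaleR_right mat_mult_add_right
  matrix_add_ldistrib mat_mult_diff_right mat_mult_diff_left

lemma inner_cvec: "x \<bullet> y = Re (\<Sum>i\<in>UNIV. cnj (x $ i) * y $ i)" for x y :: "complex^'n"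
  by (simp add: inner_vec_def inner_complex_def)

lemma inner_ctranspose: "(A *v x) \<bullet> y = x \<bullet> (ctranspose A *v y)" for A :: "complex^'n^'m"
proof -
  have "(\<Sum>i\<in>UNIV. cnj ((A *v x) $ i) * y $ i) = (\<Sum>j\<in>UNIV. cnj (x $ j) * (ctranspose A *v y) $ j)"
    by (simp add: matrix_vector_mult_def sum_distrib_left sum_distrib_right mult_ac)
      (rule sum.swap)
  then show ?thesis by (simp add: inner_cvec)
qed

lemma inner_matrix: "X \<bullet> Y = Re (trace (ctranspose X ** Y))" for X Y :: "complex^'n^'n"
  unfolding trace_def matrix_matrix_mult_def inner_vec_def
  by (simp add: inner_complex_def) (rule sum.swap)

lemma frob_norm_eq: "frob_norm X = norm X"
  by (simp add: frob_norm_def norm_eq_sqrt_inner inner_matrix)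

lemma hermitianD: "hermitian A \<Longrightarrow> ctranspose A = A"
  by (simp add: hermitian_def)

lemma hermitian_inner: "hermitian A \<Longrightarrow> (A *v x) \<bullet> y = x \<bullet> (A *v y)"
  by (simp add: inner_ctranspose hermitian_def)

lemma posdef_iff: "posdef A \<longleftrightarrow> hermitian A \<and> (\<forall>x. x \<noteq> 0 \<longrightarrow> 0 < x \<bullet> (A *v x))"
  by (simp add: posdef_def inner_cvec)

lemma posdef_hermitian: "posdef A \<Longrightarrow> hermitian A"
  by (simp add: posdef_def)

lemma posdef_pos: "posdef A \<Longrightarrow> x \<noteq> 0 \<Longrightarrow> 0 < x \<bullet> (A *v x)"
  by (simp add: posdef_iff)

lemma posdef_nonneg: "posdef A \<Longrightarrow> 0 \<le> x \<bullet> (A *v x)"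
  by (cases "x = 0") (auto simp: posdef_iff less_imp_le)

lemma unitary_ctranspose: "unitary U \<Longrightarrow> unitary (ctranspose U)"
  by (auto simp: unitary_def)

lemma unitary_left: "unitary U \<Longrightarrow> ctranspose U ** U = mat 1"
  and unitary_right: "unitary U \<Longrightarrow> U ** ctranspose U = mat 1"
  by (auto simp: unitary_def)

lemma unitary_norm: "unitary U \<Longrightarrow> norm (U *v x) = norm x"
  by (simp add: norm_eq_sqrt_inner inner_ctranspose matrix_vector_mul_assoc unitary_left)

section \<open>The spectral theorem\<close>

text \<open>The real inner product is only the real part of this one. Orthogonality of eigenvectors
  over the complex numbers also needs the imaginary part.\<close>

definition cdot :: "complex^'n \<Rightarrow> complex^'n \<Rightarrow> complex" where
  "cdot x y = (\<Sum>i\<in>UNIV. cnj (x $ i) * y $ i)"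

lemma cdot_add: "cdot (x + y) z = cdot x z + cdot y z" "cdot z (x + y) = cdot z x + cdot z y"
  by (simp_all add: cdot_def algebra_simps sum.distrib)

lemma cdot_scaleR: "cdot (c *\<^sub>R x) y = c *\<^sub>R cdot x y" "cdot x (c *\<^sub>R y) = c *\<^sub>R cdot x y"
  by (simp_all add: cdot_def scaleR_sum_right)

lemma cdot_commute: "cdot y x = cnj (cdot x y)"
  by (simp add: cdot_def mult.commute)

lemma cdot_ctranspose: "cdot (A *v x) y = cdot x (ctranspose A *v y)"
  by (simp add: cdot_def matrix_vector_mult_def sum_distrib_left sum_distrib_right mult_ac)
    (rule sum.swap)

lemma norm_cvec: "(norm x)\<^sup>2 = (\<Sum>i\<in>UNIV. (cmod (x $ i))\<^sup>2)" for x :: "complex^'n"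
  unfolding norm_vec_def L2_set_def by (rule real_sqrt_pow2) (simp add: sum_nonneg)

lemma cdot_self: "cdot x x = of_real ((norm x)\<^sup>2)"
proof -
  have "cdot x x = (\<Sum>i\<in>UNIV. complex_of_real ((cmod (x $ i))\<^sup>2))"
    unfolding cdot_def by (intro sum.cong refl) (metis complex_norm_square mult.commute of_real_power)
  then show ?thesis by (simp add: norm_cvec)
qed

lemma inner_cdot: "x \<bullet> y = Re (cdot x y)"
  by (simp add: inner_cvec cdot_def)

text \<open>The matrix with the conjugated vectors \<open>u k\<close>, k in \<open>I\<close>, as
  rows and zeros elsewhere has a zero row \<open>i\<close>. It is singular, and any kernel vector
  will do.\<close>

lemma exists_orthogonal:
  fixes u :: "'n \<Rightarrow> complex^'n"
  assumes "i \<notin> I"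
  shows "\<exists>x. x \<noteq> 0 \<and> (\<forall>k\<in>I. cdot (u k) x = 0)"
proof -
  define M :: "complex^'n^'n" where "M = (\<chi> k j. if k \<in> I then cnj (u k $ j) else 0)"
  have "row i M = 0" using assms by (simp add: M_def row_def vec_eq_iff)
  then have "det M = 0" by (rule det_zero_row(1))
  then have "\<not> invertible M" by (simp add: invertible_det_nz)
  then have "\<not> (\<exists>B. B ** M = mat 1)"
    by (metis invertible_def matrix_left_right_inverse)
  then obtain x where x: "M *v x = 0" "x \<noteq> 0" by (metis matrix_left_invertible_ker)
  have "cdot (u k) x = 0" if "k \<in> I" for k
  proof -
    have "cdot (u k) x = (M *v x) $ k" using that
      by (simp add: M_def matrix_vector_mult_def cdot_def)
    then show ?thesis using x by simp
  qed
  then show ?thesis using x by blast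
qed

text \<open>A maximizer of the quadratic form on the unit sphere of \<open>W\<close> is an
  eigenvector: moving it in the direction of its residual \<open>r\<close> would otherwise increase
  the Rayleigh quotient. Invariance keeps \<open>r\<close> inside \<open>W\<close>.\<close>

lemma hermitian_eigenvector_in_subspace:
  fixes A :: "complex^'n^'n" and W :: "(complex^'n) set"
  assumes A: "hermitian A" and W: "subspace W" and inv: "\<And>x. x \<in> W \<Longrightarrow> A *v x \<in> W"
    and z: "z \<in> W" "z \<noteq> 0"
  shows "\<exists>v\<in>W. \<exists>\<mu>::real. norm v = 1 \<and> A *v v = \<mu> *\<^sub>R v"
proof -
  define q where "q x = x \<bullet> (A *v x)" for x
  let ?S = "sphere 0 1 \<inter> W"
  have "compact ?S" using closed_subspace[OF W] by (simp add: compact_Int_closed)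
  moreover have "(1 / norm z) *\<^sub>R z \<in> ?S" using z W by (simp add: subspace_scale)
  moreover have "continuous_on ?S q" unfolding q_def
    by (intro continuous_intros linear_continuous_on matrix_vector_mul_bounded_linear)
  ultimately obtain v where v: "v \<in> ?S" "\<And>x. x \<in> ?S \<Longrightarrow> q x \<le> q v"
    using continuous_attains_sup[of ?S q] by blast
  define \<mu> where "\<mu> = q v"
  have vW: "v \<in> W" and nv: "norm v = 1" using v by auto
  have le: "q x \<le> \<mu> * (norm x)\<^sup>2" if "x \<in> W" for x
  proof (cases "x = 0")
    case False
    have "q ((1 / norm x) *\<^sub>R x) \<le> \<mu>" unfolding \<mu>_def using that False W
      by (intro v) (auto simp: subspace_scale)
    then show ?thesis using False
      by (simp add: q_def mat_vec_mult_scaleR field_simps power2_eq_square)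
  qed (simp add: q_def)
  define r where "r = A *v v - \<mu> *\<^sub>R v"
  have rW: "r \<in> W" unfolding r_def using vW W inv by (simp add: subspace_diff subspace_scale)
  \<comment> \<open>the quadratic form of \<open>\<mu> - A\<close> is nonnegative on \<open>W\<close> and vanishes at \<open>v\<close>\<close>
  have key: "0 \<le> t\<^sup>2 * (\<mu> * (norm r)\<^sup>2 - q r) - 2 * t * (norm r)\<^sup>2" for t :: real
  proof -
    have "q (v + t *\<^sub>R r) \<le> \<mu> * (norm (v + t *\<^sub>R r))\<^sup>2"
      using vW rW W by (intro le) (simp add: subspace_add subspace_scale)
    moreover have "q (v + t *\<^sub>R r) = \<mu> + 2 * t * (r \<bullet> (A *v v)) + t\<^sup>2 * q r"
      using hermitian_inner[OF A, of r v]
      by (simp add: q_def \<mu>_def matrix_vector_right_distrib mat_vec_mult_scaleR inner_add_left inner_add_right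
          inner_commute power2_eq_square algebra_simps)
    moreover have "(norm (v + t *\<^sub>R r))\<^sup>2 = 1 + 2 * t * (r \<bullet> v) + t\<^sup>2 * (norm r)\<^sup>2"
      using nv unfolding power2_norm_eq_inner
      by (simp add: inner_add_left inner_add_right inner_commute norm_eq_1)
        (simp add: power2_eq_square algebra_simps)
    moreover have "r \<bullet> (A *v v) = \<mu> * (r \<bullet> v) + (norm r)\<^sup>2"
      by (simp add: r_def power2_norm_eq_inner inner_diff_left inner_diff_right inner_commute algebra_simps)
    ultimately show ?thesis by (simp add: algebra_simps)
  qed
  have "r = 0"
  proof (rule ccontr)
    assume "r \<noteq> 0"
    define R K where "R = (norm r)\<^sup>2" and "K = \<mu> * (norm r)\<^sup>2 - q r"
    have R: "R > 0" using \<open>r \<noteq> 0\<close> by (simp add: R_def)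
    have K: "K \<ge> 0" using le[OF rW] by (simp add: K_def)
    \<comment> \<open>Any t > 0 with t K < 2 R makes the quadratic in \<open>key\<close> negative;
      adding 1 to \<open>K\<close> keeps the quotient defined when \<open>K\<close> is 0.\<close>
    define a where "a = R / (K + 1)"
    have Ra: "R = a * (K + 1)" using K by (simp add: a_def)
    have "0 \<le> a\<^sup>2 * K - 2 * a * R"
      using key unfolding R_def K_def by blast
    also have "\<dots> = a\<^sup>2 * (K - 2 * (K + 1))"
      by (simp add: Ra power2_eq_square algebra_simps)
    also have "\<dots> < 0" using R K by (intro mult_pos_neg) (auto simp: a_def)
    finally show False by simp
  qed
  then show ?thesis using vW nv by (auto simp: r_def)
qed

theorem hermitian_diagonalizable:
  fixes A :: "complex^'n^'n"
  assumes "hermitian A"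
  shows "\<exists>U d. unitary U \<and> A = U ** diag_mat d ** ctranspose U"
proof -
  \<comment> \<open>The induction runs over subsets of the index type, so that at
    \<open>UNIV\<close> the eigenvectors are already numbered as the columns of a matrix. The
    orthogonal complement of the vectors found so far is invariant because \<open>A\<close> is
    Hermitian.\<close>
  have "\<exists>u d. (\<forall>k\<in>I. A *v u k = (d k :: real) *\<^sub>R u k) \<and>
      (\<forall>k\<in>I. \<forall>l\<in>I. cdot (u k) (u l) = (if k = l then 1 else 0))" for I :: "'n set"
    using finite[of I]
  proof (induction I rule: finite_induct)
    case (insert i I)
    then obtain u d where ev: "\<And>k. k \<in> I \<Longrightarrow> A *v u k = (d k :: real) *\<^sub>R u k"
      and on: "\<And>k l. k \<in> I \<Longrightarrow> l \<in> I \<Longrightarrow> cdot (u k) (u l) = (if k = l then 1 else 0)"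
      by metis
    define W where "W = {x. \<forall>k\<in>I. cdot (u k) x = 0}"
    have "subspace W"
      by (auto simp: W_def subspace_def cdot_add cdot_scaleR) (simp add: cdot_def)
    moreover have "A *v x \<in> W" if "x \<in> W" for x
      using that ev assms by (auto simp: W_def cdot_scaleR hermitianD
          cdot_ctranspose[where A = "ctranspose A", simplified, symmetric])
    moreover obtain z where "z \<in> W" "z \<noteq> 0"
      using exists_orthogonal[OF insert(2)] unfolding W_def by blast
    ultimately obtain v \<mu> where v: "v \<in> W" "norm v = 1" "A *v v = (\<mu>::real) *\<^sub>R v"
      using hermitian_eigenvector_in_subspace[OF assms] by metis
    have "cdot v (u k) = 0" if "k \<in> I" for k
      using v that cdot_commute[of v "u k"] by (simp add: W_def)
    then show ?case using v ev on insert(2)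
      by (intro exI[of _ "u(i := v)"] exI[of _ "d(i := \<mu>)"])
        (auto simp: W_def cdot_self[of v])
  qed simp
  from this[of UNIV] obtain u :: "'n \<Rightarrow> complex^'n" and d where "\<forall>k\<in>UNIV. A *v u k = (d k :: real) *\<^sub>R u k"
    and "\<forall>k\<in>UNIV. \<forall>l\<in>UNIV. cdot (u k) (u l) = (if k = l then 1 else 0)" by blast
  then have ev: "A *v u k = d k *\<^sub>R u k" and on: "cdot (u k) (u l) = (if k = l then 1 else 0)" for k l
    by simp_all
  define U :: "complex^'n^'n" where "U = (\<chi> i j. u j $ i)"
  have "ctranspose U ** U = mat 1"
    using on by (simp add: vec_eq_iff U_def matrix_matrix_mult_def cdot_def mat_def)
  then have U: "unitary U" by (simp add: unitary_def matrix_left_right_inverse)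
  have "A ** U = U ** diag_mat d"
  proof -
    have "(A ** U) $ i $ j = (A *v u j) $ i" for i j
      by (simp add: U_def matrix_matrix_mult_def matrix_vector_mult_def)
    then show ?thesis using ev
      by (simp add: vec_eq_iff diag_mat_mult_right) (simp add: U_def scaleR_conv_of_real)
  qed
  then have "A = U ** diag_mat d ** ctranspose U"
    by (metis U matrix_mul_assoc matrix_mul_rid unitary_right)
  with U show ?thesis by blast
qed

section \<open>Calculus of unitary diagonalizations and coordinates in an eigenbasis\<close>

definition udiag :: "complex^'n^'n \<Rightarrow> ('n \<Rightarrow> real) \<Rightarrow> complex^'n^'n" where
  "udiag U d = U ** diag_mat d ** ctranspose U"

lemma fun_calc_udiag: "unitary U \<Longrightarrow> fun_calc f (udiag U d) = udiag U (\<lambda>i. f (d i))"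
  unfolding udiag_def by (rule fun_calc_eq)

lemma hermitian_udiag [simp]: "hermitian (udiag U d)"
  by (simp add: hermitian_def udiag_def ctranspose_mult matrix_mul_assoc)

lemma diag_mat_mult: "diag_mat d ** diag_mat e = diag_mat (\<lambda>i. d i * e i)"
  by (simp add: vec_eq_iff diag_mat_mult_left) (simp add: diag_mat_def)

lemma udiag_mult:
  assumes "unitary U"
  shows "udiag U d ** udiag U e = udiag U (\<lambda>i. d i * e i)"
proof -
  have "udiag U d ** udiag U e = U ** diag_mat d ** (ctranspose U ** U) ** diag_mat e ** ctranspose U"
    by (simp add: udiag_def matrix_mul_assoc)
  then show ?thesis
    by (simp add: unitary_left[OF assms] udiag_def diag_mat_mult[symmetric] matrix_mul_assoc)
qed

lemma udiag_add: "udiag U d + udiag U e = udiag U (\<lambda>i. d i + e i)"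
proof -
  have "diag_mat d + diag_mat e = diag_mat (\<lambda>i. d i + e i)"
    by (simp add: vec_eq_iff diag_mat_def)
  then show ?thesis
    by (metis (no_types, lifting) udiag_def mat_mult_add_right matrix_add_ldistrib)
qed

lemma udiag_scaleR: "c *\<^sub>R udiag U d = udiag U (\<lambda>i. c * d i)"
proof -
  have "c *\<^sub>R diag_mat d = diag_mat (\<lambda>i. c * d i)"
    by (simp add: vec_eq_iff diag_mat_def) (simp add: scaleR_conv_of_real)
  then show ?thesis
    by (metis (no_types, lifting) udiag_def mat_mult_scaleR_left mat_mult_scaleR_right)
qed

lemma udiag_const: "unitary U \<Longrightarrow> udiag U (\<lambda>_. c) = c *\<^sub>R mat 1"
proof -
  assume U: "unitary U"
  have D: "diag_mat (\<lambda>_. c) = (c *\<^sub>R mat 1 :: complex^'n^'n)"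
    by (simp add: vec_eq_iff diag_mat_def mat_def) (simp add: scaleR_conv_of_real)
  show ?thesis unfolding udiag_def D
    by (simp add: mat_mult_scaleR_left mat_mult_scaleR_right unitary_right[OF U])
qed

lemma hermitian_cases:
  assumes "hermitian A"
  obtains U d where "unitary U" "A = udiag U d"
  using hermitian_diagonalizable[OF assms] by (auto simp: udiag_def)

text \<open>The weight with which \<open>d i\<close> enters the quadratic form of
  \<open>udiag U d\<close> at \<open>x\<close>. For unitary \<open>U\<close> and a unit vector
  \<open>x\<close> these weights form a probability distribution.\<close>

definition coord :: "complex^'n^'n \<Rightarrow> complex^'n \<Rightarrow> 'n \<Rightarrow> real" where
  "coord U x i = (cmod ((ctranspose U *v x) $ i))\<^sup>2"

lemma coord_nonneg [simp]: "0 \<le> coord U x i"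
  by (simp add: coord_def)

lemma quad_diag_mat: "x \<bullet> (diag_mat d *v x) = (\<Sum>i\<in>UNIV. d i * (cmod (x $ i))\<^sup>2)"
proof -
  have "(diag_mat d *v x) $ i = of_real (d i) * x $ i" for i
    by (simp add: diag_mat_def matrix_vector_mult_def if_distrib[where f = "\<lambda>x. x * _"] cong: if_cong)
  then show ?thesis unfolding inner_vec_def
    by (intro sum.cong refl) (simp add: inner_complex_def cmod_power2, simp add: algebra_simps power2_eq_square)
qed

lemma quad_udiag: "x \<bullet> (udiag U d *v x) = (\<Sum>i\<in>UNIV. d i * coord U x i)"
proof -
  have "x \<bullet> (udiag U d *v x) = (ctranspose U *v x) \<bullet> (diag_mat d *v (ctranspose U *v x))"
    unfolding inner_ctranspose by (simp add: udiag_def matrix_vector_mul_assoc matrix_mul_assoc)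
  then show ?thesis by (simp only: quad_diag_mat coord_def)
qed

lemma sum_coord: "unitary U \<Longrightarrow> (\<Sum>i\<in>UNIV. coord U x i) = (norm x)\<^sup>2"
  by (simp only: coord_def norm_cvec[symmetric] unitary_norm[OF unitary_ctranspose])

lemma ctranspose_mult_nth: "(ctranspose U ** V) $ i $ j = cdot (column i U) (column j V)"
  by (simp add: matrix_matrix_mult_def cdot_def column_def)

lemma ctranspose_vec_nth: "(ctranspose U *v x) $ i = cdot (column i U) x"
  by (simp add: matrix_vector_mult_def cdot_def column_def)

lemma coord_eq: "coord U x i = (cmod (cdot (column i U) x))\<^sup>2"
  by (simp add: coord_def ctranspose_vec_nth)

lemma cdot_columns: "unitary U \<Longrightarrow> cdot (column i U) (column j U) = (if i = j then 1 else 0)"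
  using unitary_left[of U] by (simp add: ctranspose_mult_nth[symmetric] mat_def)

lemma coord_column: "unitary U \<Longrightarrow> coord U (column j U) i = (if i = j then 1 else 0)"
  by (simp add: coord_eq cdot_columns)

lemma norm_column: "unitary U \<Longrightarrow> norm (column j U) = 1"
  using sum_coord[of U "column j U"] by (simp add: coord_column power2_eq_1_iff) (smt (verit) norm_ge_zero)

lemma column_nonzero: "unitary U \<Longrightarrow> column j U \<noteq> 0"
  using norm_column[of U j] by auto

lemma udiag_column:
  assumes "unitary U"
  shows "udiag U d *v column j U = d j *\<^sub>R column j U"
proof -
  have "udiag U d ** U = U ** diag_mat d"
    by (simp add: udiag_def matrix_mul_assoc[symmetric] unitary_left[OF assms])
  then have "(udiag U d ** U) $ i $ j = (U ** diag_mat d) $ i $ j" for i by simp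
  then show ?thesis
    by (simp add: vec_eq_iff diag_mat_mult_right)
      (simp add: column_def matrix_matrix_mult_def matrix_vector_mult_def scaleR_conv_of_real)
qed

lemma quad_udiag_column: "unitary U \<Longrightarrow> column j U \<bullet> (udiag U d *v column j U) = d j"
  by (simp add: udiag_column norm_column dot_square_norm)

lemma posdef_udiag: "unitary U \<Longrightarrow> posdef (udiag U d) \<longleftrightarrow> (\<forall>i. 0 < d i)"
proof (intro iffI allI)
  assume U: "unitary U"
  show "0 < d i" if "posdef (udiag U d)" for i
    using posdef_pos[OF that column_nonzero[OF U]] by (simp add: quad_udiag_column U)
  assume pos: "\<forall>i. 0 < d i"
  have "0 < x \<bullet> (udiag U d *v x)" if "x \<noteq> 0" for x
  proof -
    have "(\<Sum>i\<in>UNIV. coord U x i) \<noteq> 0" using that by (simp add: sum_coord U)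
    then obtain i where "coord U x i \<noteq> 0" by (metis sum.neutral)
    then show ?thesis unfolding quad_udiag using pos
      by (intro sum_pos2[of _ i]) (auto simp: less_le)
  qed
  then show "posdef (udiag U d)" by (simp add: posdef_iff)
qed

lemma posdef_cases:
  assumes "posdef A"
  obtains U d where "unitary U" "A = udiag U d" "\<And>i. 0 < d i"
  using hermitian_cases[OF posdef_hermitian[OF assms]] assms posdef_udiag by metis

lemma det_ctranspose_unitary: "unitary U \<Longrightarrow> det U * det (ctranspose U) = 1"
  by (metis det_I det_mul unitary_right)

lemma det_udiag:
  assumes "unitary U"
  shows "det (udiag U d) = of_real (\<Prod>i\<in>UNIV. d i)"
proof -
  have "det (diag_mat d) = (\<Prod>i\<in>UNIV. of_real (d i))"
    using det_diagonal[of "diag_mat d"] by (simp add: diag_mat_def)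
  then show ?thesis using det_ctranspose_unitary[OF assms]
    by (simp add: udiag_def det_mul mult_ac)
qed

lemma trace_udiag:
  assumes "unitary U"
  shows "trace (udiag U d) = of_real (\<Sum>i\<in>UNIV. d i)"
proof -
  have "trace (udiag U d) = trace (ctranspose U ** U ** diag_mat d)"
    unfolding udiag_def by (subst trace_mul_sym) (simp add: matrix_mul_assoc)
  then show ?thesis by (simp add: unitary_left[OF assms]) (simp add: trace_def diag_mat_def)
qed

lemma column_mult: "column j (A ** B) = A *v column j B" for A :: "complex^'n^'m"
  by (simp add: vec_eq_iff column_def matrix_matrix_mult_def matrix_vector_mult_def)

lemma sum_quad_columns:
  assumes "unitary U"
  shows "(\<Sum>i\<in>UNIV. column i U \<bullet> (A *v column i U)) = Re (trace A)"
proof -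
  have "(\<Sum>i\<in>UNIV. column i U \<bullet> (A *v column i U)) = Re (trace (ctranspose U ** (A ** U)))"
    by (simp add: trace_def ctranspose_mult_nth inner_cdot column_mult)
 then show ?thesis
    by (subst (asm) trace_mul_sym) (simp add: matrix_mul_assoc[symmetric] unitary_right assms)
qed

section \<open>Eigenvalues and majorization\<close>

lemma sum_pCons_linear: "(\<Sum>k\<in>I. [:f k, g k:]) = [:\<Sum>k\<in>I. f k, \<Sum>k\<in>I. g k:]"
  by (induction I rule: infinite_finite_induct) auto

text \<open>Over the polynomial ring the characteristic matrix factors as U Q U^(-1) with
  \<open>Q\<close> the diagonal matrix of linear factors. \<open>K\<close> embeds constant matrices
  into polynomial ones and respects products, so the outer determinants cancel.\<close>

lemma charpoly_udiag:
  fixes U :: "complex^'n^'n"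
  assumes U: "unitary U"
  shows "charpoly (udiag U d) = (\<Prod>i\<in>UNIV. [:- complex_of_real (d i), 1:])"
proof -
  define K :: "complex^'n^'n \<Rightarrow> complex poly^'n^'n" where "K M = (\<chi> i j. [:M $ i $ j:])" for M
  define Q :: "complex poly^'n^'n" where
    "Q = (\<chi> i j. if i = j then [:- complex_of_real (d i), 1:] else 0)"
  have sum_const: "(\<Sum>k\<in>I. [:f k:]) = [:\<Sum>k\<in>I. f k:]" for f :: "'n \<Rightarrow> complex" and I
    by (induction I rule: infinite_finite_induct) auto
  have K_mult: "K M ** K N = K (M ** N)" for M N
    by (simp add: K_def matrix_matrix_mult_def sum_const vec_eq_iff mult.commute)
  have KUU: "K U ** K (ctranspose U) = mat 1"
    by (simp add: K_mult unitary_right[OF U]) (simp add: K_def mat_def vec_eq_iff)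
  have UU: "(\<Sum>k\<in>UNIV. U $ i $ k * cnj (U $ j $ k)) = (if i = j then 1 else 0)" for i j
  proof -
    have "(U ** ctranspose U) $ i $ j = (if i = j then 1 else 0)"
      by (simp add: unitary_right[OF U] mat_def)
    then show ?thesis by (simp add: matrix_matrix_mult_def)
  qed
  have entry: "udiag U d $ i $ j = (\<Sum>k\<in>UNIV. U $ i $ k * of_real (d k) * cnj (U $ j $ k))" for i j
    by (simp add: udiag_def matrix_matrix_mult_def[of _ "ctranspose U"] diag_mat_mult_right)
  have KQ: "(K U ** Q) $ i $ k = [:U $ i $ k:] * [:- complex_of_real (d k), 1:]" for i k
    by (simp add: K_def Q_def matrix_matrix_mult_def if_distrib[where f = "\<lambda>x. _ * x"] cong: if_cong)
  have "(K U ** Q ** K (ctranspose U)) $ i $ j =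
      (if i = j then [:0, 1:] else 0) - [:udiag U d $ i $ j:]" for i j
  proof -
    have "(K U ** Q ** K (ctranspose U)) $ i $ j =
        (\<Sum>k\<in>UNIV. [:- (U $ i $ k * of_real (d k) * cnj (U $ j $ k)), U $ i $ k * cnj (U $ j $ k):])"
      unfolding matrix_matrix_mult_def[of _ "K (ctranspose U)"]
      by (simp add: KQ) (simp add: K_def mult_ac)
    also have "\<dots> = (if i = j then [:0, 1:] else 0) - [:udiag U d $ i $ j:]"
      unfolding sum_pCons_linear by (simp add: UU entry sum_negf)
    finally show ?thesis .
  qed
  then have "charpoly (udiag U d) = det (K U ** Q ** K (ctranspose U))"
    unfolding charpoly_def by (intro arg_cong[where f = det]) (simp add: vec_eq_iff)
  also have "\<dots> = det (K U ** K (ctranspose U)) * det Q"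
    by (simp only: det_mul mult_ac)
  also have "det Q = (\<Prod>i\<in>UNIV. [:- complex_of_real (d i), 1:])"
    by (subst det_diagonal) (auto simp: Q_def)
  finally show ?thesis by (simp add: KUU)
qed

lemma eigvals_udiag:
  fixes U :: "complex^'n^'n"
  assumes "unitary U"
  shows "eigvals (udiag U d) = sorted_list_of_multiset (image_mset d (mset_set UNIV))"
proof -
  have "proots (\<Prod>i\<in>I. [:- complex_of_real (d i), 1:]) = image_mset (\<lambda>i. of_real (d i)) (mset_set I)"
    for I :: "'n set"
    using finite[of I]
  proof (induction I rule: finite_induct)
    case (insert i I)
    then show ?case
      by (subst prod.insert) (auto simp: proots_mult simp del: mult_pCons_left)
  qed simp
  then have "proots (charpoly (udiag U d)) = image_mset (\<lambda>i. of_real (d i)) (mset_set UNIV)"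
    by (simp add: charpoly_udiag[OF assms])
  then show ?thesis by (simp add: eigvals_def image_mset.compositionality o_def)
qed

text \<open>With repeated eigenvalues the set of the k largest ones is ambiguous; this predicate
  admits every possible choice.\<close>

definition top_set :: "('n \<Rightarrow> real) \<Rightarrow> 'n set \<Rightarrow> bool" where
  "top_set d S \<longleftrightarrow> (\<forall>i\<in>S. \<forall>j\<in>-S. d j \<le> d i)"

lemma decr_rearr_eigvals:
  fixes U :: "complex^'n^'n"
  assumes "unitary U"
  obtains ks :: "'n list" where "distinct ks" "set ks = UNIV"
    "sorted_wrt (\<lambda>i j. d j \<le> d i) ks" "decr_rearr (eigvals (udiag U d)) = map d ks"
proof -
  obtain xs :: "'n list" where xs: "set xs = UNIV" "distinct xs"
    using finite_distinct_list[OF finite[of UNIV]] by blast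
  define ks where "ks = sort_key (\<lambda>i. - d i) xs"
  have ks: "distinct ks" "set ks = UNIV" using xs by (auto simp: ks_def)
  have "sorted (map (\<lambda>i. - d i) ks)" by (simp add: ks_def)
  then have srt: "sorted_wrt (\<lambda>i j. d j \<le> d i) ks" by (simp add: sorted_wrt_map)
  have "mset ks = mset_set UNIV" by (metis ks mset_set_set)
  then have "mset (rev (map d ks)) = mset (eigvals (udiag U d))"
    by (simp add: eigvals_udiag[OF assms])
  moreover have "sorted (rev (map d ks))"
    using srt by (simp add: sorted_wrt_rev sorted_wrt_map)
  ultimately have "sort (eigvals (udiag U d)) = rev (map d ks)"
    by (rule properties_for_sort)
  then have "decr_rearr (eigvals (udiag U d)) = map d ks" by (simp add: decr_rearr_def)
  with ks srt that show thesis by blast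
qed

lemma length_eigvals: "unitary U \<Longrightarrow> length (eigvals (udiag U d)) = CARD('n)" for U :: "complex^'n^'n"
  by (metis eigvals_udiag mset_sorted_list_of_multiset size_image_mset size_mset size_mset_set)

lemma top_set_eigvals:
  fixes U :: "complex^'n^'n"
  assumes "unitary U" "k \<le> CARD('n)"
  obtains S where "card S = k" "top_set d S"
    "prod_list (take k (decr_rearr (eigvals (udiag U d)))) = prod d S"
proof -
  obtain ks :: "'n list" where ks: "distinct ks" "set ks = UNIV"
    "sorted_wrt (\<lambda>i j. d j \<le> d i) ks" "decr_rearr (eigvals (udiag U d)) = map d ks"
    using decr_rearr_eigvals[OF assms(1)] by blast
  define S where "S = set (take k ks)"
  have len: "length ks = CARD('n)" using ks by (metis distinct_card)
  have S: "card S = k" unfolding S_def using ks assms len by (simp add: distinct_card)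
  have "- S \<subseteq> set (drop k ks)"
  proof -
    have "set (take k ks) \<union> set (drop k ks) = UNIV"
      by (metis append_take_drop_id ks(2) set_append)
    then show ?thesis unfolding S_def by blast
  qed
  moreover have "\<forall>i\<in>S. \<forall>j\<in>set (drop k ks). d j \<le> d i"
    using ks(3) unfolding S_def by (metis append_take_drop_id sorted_wrt_append)
  ultimately have "top_set d S" by (auto simp: top_set_def)
  moreover have "prod_list (take k (map d ks)) = prod d S"
    unfolding S_def using ks(1) by (simp add: take_map prod.distinct_set_conv_list)
  ultimately show thesis using that S ks(4) by simp
qed

lemma prod_list_eigvals:
  assumes "unitary U"
  shows "prod_list (decr_rearr (eigvals (udiag U d))) = prod d UNIV"
  using decr_rearr_eigvals[OF assms, of d] by (metis prod.distinct_set_conv_list)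

lemma wlog_majorizedI:
  fixes U V :: "complex^'n^'n"
  assumes U: "unitary U" and V: "unitary V"
    and le: "\<And>S T. card S = card T \<Longrightarrow> S \<noteq> {} \<Longrightarrow> top_set d S \<Longrightarrow> top_set e T \<Longrightarrow> prod d S \<le> prod e T"
  shows "eigvals (udiag U d) \<prec>wlog eigvals (udiag V e)"
  unfolding wlog_majorized_def
proof (intro conjI ballI)
  fix k assume "k \<in> {1..length (eigvals (udiag U d))}"
  then have k: "1 \<le> k" "k \<le> CARD('n)" by (simp_all add: length_eigvals U)
  obtain S where S: "card S = k" "top_set d S"
    "prod_list (take k (decr_rearr (eigvals (udiag U d)))) = prod d S"
    using top_set_eigvals[OF U k(2)] by blast
  obtain T where T: "card T = k" "top_set e T"
    "prod_list (take k (decr_rearr (eigvals (udiag V e)))) = prod e T"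
    using top_set_eigvals[OF V k(2)] by blast
  have "S \<noteq> {}" using S(1) k by auto
  with S T show "prod_list (take k (decr_rearr (eigvals (udiag U d))))
      \<le> prod_list (take k (decr_rearr (eigvals (udiag V e))))"
    using le by simp
qed (simp add: length_eigvals U V)

text \<open>The left side is the sum of h k * p k, where each weight satisfies 0 <= p k <= 1
  (Bessel's inequality) and the total weight is \<open>card T\<close>. After subtracting the
  threshold \<open>c\<close>, the terms in \<open>T\<close> are largest at full weight and all
  others are nonpositive.\<close>

lemma ky_fan_maximum:
  fixes U V :: "complex^'n^'n"
  assumes U: "unitary U" and V: "unitary V" and card: "card S = card T" and top: "top_set h T"
  shows "(\<Sum>i\<in>S. column i U \<bullet> (udiag V h *v column i U)) \<le> sum h T"
proof (cases "T = {}")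
  case True
  then show ?thesis using card by simp
next
  case False
  define p where "p k = (\<Sum>i\<in>S. coord V (column i U) k)" for k
  define c where "c = Min (h ` T)"
  have cT: "c \<le> h k" if "k \<in> T" for k using that by (simp add: c_def)
  have "c \<in> h ` T" using False by (simp add: c_def)
  then have cN: "h k \<le> c" if "k \<notin> T" for k using that top by (auto simp: top_set_def)
  have p0: "0 \<le> p k" for k by (simp add: p_def sum_nonneg)
  have p1: "p k \<le> 1" for k
  proof -
    have "coord V (column i U) k = coord U (column k V) i" for i
      by (metis coord_eq cdot_commute complex_mod_cnj)
    then have "p k \<le> (\<Sum>i\<in>UNIV. coord U (column k V) i)"
      unfolding p_def by (auto intro: sum_mono2)
    then show ?thesis by (simp add: sum_coord U norm_column V)
  qed
  have "(\<Sum>k\<in>UNIV. p k) = (\<Sum>i\<in>S. \<Sum>k\<in>UNIV. coord V (column i U) k)"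
    unfolding p_def by (rule sum.swap)
  then have ps: "(\<Sum>k\<in>UNIV. p k) = card T" by (simp add: sum_coord V norm_column U card)
  have "(\<Sum>i\<in>S. column i U \<bullet> (udiag V h *v column i U)) = (\<Sum>k\<in>UNIV. h k * p k)"
    unfolding quad_udiag p_def by (simp add: sum_distrib_left) (rule sum.swap)
  also have "\<dots> = (\<Sum>k\<in>UNIV. (h k - c) * p k) + c * card T"
    by (simp add: left_diff_distrib sum_subtractf sum_distrib_left[symmetric] ps)
  also have "(\<Sum>k\<in>UNIV. (h k - c) * p k) \<le> (\<Sum>k\<in>UNIV. if k \<in> T then h k - c else 0)"
    by (intro sum_mono) (auto simp: cT cN p0 p1 mult_left_le mult_nonpos_nonneg)
  also have "\<dots> = sum h T - c * card T"
    by (simp add: sum.If_cases sum_subtractf)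
  finally show ?thesis by simp
qed

section \<open>The logarithm of a positive definite matrix\<close>

lemma mat_log_udiag: "unitary U \<Longrightarrow> mat_log (udiag U d) = udiag U (\<lambda>i. ln (d i))"
  by (simp add: mat_log_def fun_calc_udiag)

lemma mat_powr_udiag: "unitary U \<Longrightarrow> mat_powr (udiag U d) p = udiag U (\<lambda>i. d i powr p)"
  by (simp add: mat_powr_def fun_calc_udiag)

lemma mat_exp_udiag: "unitary U \<Longrightarrow> mat_exp (udiag U d) = udiag U (\<lambda>i. exp (d i))"
  by (simp add: mat_exp_def fun_calc_udiag)

lemma hermitian_mat_log: "posdef A \<Longrightarrow> hermitian (mat_log A)"
  by (metis hermitian_udiag mat_log_udiag posdef_cases)

lemma posdef_mat_powr: "posdef A \<Longrightarrow> posdef (mat_powr A p)"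
  by (elim posdef_cases) (simp add: mat_powr_udiag posdef_udiag, metis less_irrefl)

lemma mat_powr_mult: "posdef A \<Longrightarrow> mat_powr A p ** mat_powr A q = mat_powr A (p + q)"
  by (elim posdef_cases) (simp add: mat_powr_udiag udiag_mult powr_add)

lemma mat_powr_one: "posdef A \<Longrightarrow> mat_powr A 1 = A"
  by (elim posdef_cases) (simp add: mat_powr_udiag less_imp_le)

lemma mat_powr_zero: "posdef A \<Longrightarrow> mat_powr A 0 = mat 1"
proof (elim posdef_cases)
  fix U d assume U: "unitary U" "A = udiag U d" and d: "\<And>i. 0 < d i"
  have "d i powr 0 = 1" for i using d[of i] by simp
  then show ?thesis by (simp only: U mat_powr_udiag udiag_const scaleR_one)
qed

lemma mat_powr_half_square: "posdef P \<Longrightarrow> mat_powr P (1/2) ** mat_powr P (1/2) = P"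
  by (simp add: mat_powr_mult mat_powr_one)

lemma mat_powr_half_inverse:
  assumes "posdef P"
  shows "mat_powr P (1/2) ** mat_powr P (-1/2) = mat 1" "mat_powr P (-1/2) ** mat_powr P (1/2) = mat 1"
  using assms by (simp_all add: mat_powr_mult mat_powr_zero)

lemma mat_powr_inverse:
  assumes "posdef T"
  shows "T ** mat_powr T (-1) = mat 1" "mat_powr T (-1) ** T = mat 1"
  using mat_powr_mult[OF assms, of 1 "-1"] mat_powr_mult[OF assms, of "-1" 1]
  by (simp_all add: mat_powr_one mat_powr_zero assms)

lemma mat_log_powr: "posdef A \<Longrightarrow> mat_log (mat_powr A p) = p *\<^sub>R mat_log A"
  by (elim posdef_cases) (simp add: mat_log_udiag mat_powr_udiag udiag_scaleR ln_powr)

lemma mat_log_scaleR: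
  assumes "posdef A" "0 < c"
  shows "mat_log (c *\<^sub>R A) = ln c *\<^sub>R mat 1 + mat_log A"
  using assms(1)
proof (rule posdef_cases)
  fix U d assume U: "unitary U" and A: "A = udiag U d" and d: "\<And>i. 0 < d i"
  show ?thesis unfolding A udiag_scaleR mat_log_udiag[OF U] udiag_const[OF U, symmetric] udiag_add
    using d assms(2) by (simp add: ln_mult less_imp_neq[symmetric])
qed

lemma det_posdef:
  assumes "posdef A"
  shows "Re (trace (mat_log A)) = ln (cmod (det A))" "0 < cmod (det A)"
proof -
  obtain U d where U: "unitary U" "A = udiag U d" and d: "\<And>i. 0 < d i"
    using posdef_cases[OF assms] by blast
  have "(\<Prod>i\<in>UNIV. d i) > 0" using d by (simp add: prod_pos)
  then have "cmod (det A) = (\<Prod>i\<in>UNIV. d i)" using U by (simp add: det_udiag del: of_real_prod)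
  then show "Re (trace (mat_log A)) = ln (cmod (det A))" "0 < cmod (det A)" using U d
    by (simp_all add: mat_log_udiag trace_udiag ln_prod less_imp_neq[symmetric] prod_pos)
qed

text \<open>Completing the square at z = E^(-1) v, with E = \<open>udiag U e\<close>. Equality holds
  at x = z, so this is the variational formula for the quadratic form of the inverse.\<close>

lemma quad_inverse_bound:
  assumes U: "unitary U" and e: "\<And>i. 0 < e i"
  shows "2 * (v \<bullet> x) - x \<bullet> (udiag U e *v x) \<le> v \<bullet> (udiag U (\<lambda>i. 1 / e i) *v v)"
proof -
  define z where "z = udiag U (\<lambda>i. 1 / e i) *v v"
  have Ez: "udiag U e *v z = v"
    using e by (simp add: z_def matrix_vector_mul_assoc udiag_mult U less_imp_neq[symmetric] udiag_const)
  have "0 \<le> (x - z) \<bullet> (udiag U e *v (x - z))"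
    by (intro posdef_nonneg) (simp add: posdef_udiag U e)
  also have "\<dots> = x \<bullet> (udiag U e *v x) - x \<bullet> v - z \<bullet> (udiag U e *v x) + z \<bullet> v"
    by (simp add: matrix_vector_mult_diff_distrib Ez inner_diff_left inner_diff_right)
  also have "z \<bullet> (udiag U e *v x) = v \<bullet> x"
    by (metis Ez hermitian_inner hermitian_udiag)
  finally show ?thesis by (simp add: z_def inner_commute)
qed

text \<open>The contraction property lets the pulled-back form survive a shift: the form of B + t at
  C x is at most that of M + t at x, for every t >= 0. This orders the resolvents at
  \<open>v\<close>. The integral over t appears as monotonicity of \<open>F\<close>, whose
  derivative is the difference of resolvents and which tends to 0 at infinity, so \<open>F 0\<close>
  <= 0.\<close>

lemma quad_log_mono:
  assumes B: "posdef B" and M: "posdef M"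
    and C: "\<And>x. norm (C *v x) \<le> norm x" and v: "\<And>x. v \<bullet> (C *v x) = v \<bullet> x"
    and le: "\<And>x. (C *v x) \<bullet> (B *v (C *v x)) \<le> x \<bullet> (M *v x)"
  shows "v \<bullet> (mat_log B *v v) \<le> v \<bullet> (mat_log M *v v)"
proof -
  obtain U b where U: "unitary U" "B = udiag U b" and b: "\<And>i. 0 < b i"
    using posdef_cases[OF B] by blast
  obtain V m where V: "unitary V" "M = udiag V m" and m: "\<And>i. 0 < m i"
    using posdef_cases[OF M] by blast
  define p q where "p = coord V v" and "q = coord U v"
  have shift: "x \<bullet> (udiag W (\<lambda>i. e i + t) *v x) = x \<bullet> (udiag W e *v x) + t * (norm x)\<^sup>2"
    if "unitary W" for W e t x
    by (simp add: quad_udiag sum_coord[OF that, symmetric] sum_distrib_left sum.distrib algebra_simps)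
  have resolvent: "(\<Sum>i\<in>UNIV. 1 / (m i + t) * p i) \<le> (\<Sum>i\<in>UNIV. 1 / (b i + t) * q i)"
    if t: "0 \<le> t" for t
  proof -
    have mt: "0 < m i + t" and bt: "0 < b i + t" for i using m[of i] b[of i] t by auto
    \<comment> \<open>The optimal vector in the variational formula for (M + t)^(-1); its image
      \<open>C *v y\<close> then serves as a trial vector for (B + t)^(-1).\<close>
    define y where "y = udiag V (\<lambda>i. 1 / (m i + t)) *v v"
    have My: "udiag V (\<lambda>i. m i + t) *v y = v"
      using mt by (simp add: y_def matrix_vector_mul_assoc udiag_mult V less_imp_neq[symmetric] udiag_const)
    have "v \<bullet> y = 2 * (v \<bullet> y) - y \<bullet> (udiag V (\<lambda>i. m i + t) *v y)"
      by (simp add: My inner_commute)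
    also have "\<dots> = 2 * (v \<bullet> (C *v y)) - (y \<bullet> (M *v y) + t * (norm y)\<^sup>2)"
      by (simp add: shift V v)
    also have "\<dots> \<le> 2 * (v \<bullet> (C *v y)) - ((C *v y) \<bullet> (B *v (C *v y)) + t * (norm (C *v y))\<^sup>2)"
      using le[of y] t C[of y] by (intro diff_left_mono add_mono mult_left_mono power_mono) auto
    also have "\<dots> \<le> v \<bullet> (udiag U (\<lambda>i. 1 / (b i + t)) *v v)"
      using quad_inverse_bound[OF U(1) bt, of v "C *v y"] by (simp add: shift U)
    finally show ?thesis by (simp add: y_def quad_udiag p_def q_def)
  qed
  define F where "F t = (\<Sum>i\<in>UNIV. q i * ln (b i + t)) - (\<Sum>i\<in>UNIV. p i * ln (m i + t))" for t
  have F_mono: "F 0 \<le> F T" if "0 \<le> T" for T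
  proof (rule DERIV_nonneg_imp_nondecreasing[OF that])
    fix t assume "0 \<le> t" "t \<le> T"
    then have mt: "0 < m i + t" and bt: "0 < b i + t" for i using m[of i] b[of i] by auto
    have "(F has_real_derivative
        (\<Sum>i\<in>UNIV. 1 / (b i + t) * q i) - (\<Sum>i\<in>UNIV. 1 / (m i + t) * p i)) (at t)"
      unfolding F_def using mt bt by (auto intro!: derivative_eq_intros simp: field_simps)
    then show "\<exists>y. (F has_real_derivative y) (at t) \<and> 0 \<le> y"
      using resolvent[OF \<open>0 \<le> t\<close>] by auto
  qed
  \<comment> \<open>Both weight families add up to the squared norm of \<open>v\<close>, so ln t may
    be subtracted from every logarithm; each term then tends to 0.\<close>
  have F_eq: "F t = (\<Sum>i\<in>UNIV. q i * (ln (b i + t) - ln t)) - (\<Sum>i\<in>UNIV. p i * (ln (m i + t) - ln t))" for t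
    by (simp add: F_def right_diff_distrib sum_subtractf sum_distrib_right[symmetric] p_def q_def sum_coord U V)
  have lim: "((\<lambda>t. ln (a + t) - ln t) \<longlongrightarrow> 0) at_top" if "0 < a" for a :: real
    using that by real_asymp
  have "(F \<longlongrightarrow> (\<Sum>i\<in>UNIV. q i * 0) - (\<Sum>i\<in>UNIV. p i * 0)) at_top"
    unfolding F_eq by (intro tendsto_intros lim m b)
  then have "F 0 \<le> 0"
    by (intro tendsto_lowerbound[of F 0 at_top]) (auto intro: F_mono eventually_mono[OF eventually_ge_at_top[of 0]])
  then show ?thesis
    by (simp add: F_def U V mat_log_udiag quad_udiag p_def q_def mult.commute)
qed

section \<open>Congruences, contractions and the determinant\<close>

lemma quad_congruence:
  assumes "hermitian C"
  shows "x \<bullet> ((C ** B ** C) *v x) = (C *v x) \<bullet> (B *v (C *v x))"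
  using assms by (simp add: hermitian_inner matrix_vector_mul_assoc matrix_mul_assoc)

lemma hermitian_congruence: "hermitian C \<Longrightarrow> hermitian B \<Longrightarrow> hermitian (C ** B ** C)"
  by (simp add: hermitian_def ctranspose_mult matrix_mul_assoc)

lemma posdef_kernel: "posdef C \<Longrightarrow> x \<noteq> 0 \<Longrightarrow> C *v x \<noteq> 0"
  using posdef_pos[of C x] by auto

lemma posdef_congruence:
  assumes "posdef C" "posdef B"
  shows "posdef (C ** B ** C)"
  using assms by (auto simp: posdef_iff[of "C ** B ** C"] hermitian_congruence posdef_hermitian
      quad_congruence posdef_kernel posdef_pos)

lemma posdef_scaleR: "posdef A \<Longrightarrow> 0 < c \<Longrightarrow> posdef (c *\<^sub>R A)"
  by (simp add: posdef_iff hermitian_def ctranspose_scaleR mat_mult_vec_scaleR)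

lemma norm_udiag_le:
  assumes U: "unitary U" and e: "\<And>i. \<bar>e i\<bar> \<le> 1"
  shows "norm (udiag U e *v x) \<le> norm x"
proof -
  have "(norm (udiag U e *v x))\<^sup>2 = x \<bullet> (udiag U (\<lambda>i. e i * e i) *v x)"
    by (simp add: power2_norm_eq_inner hermitian_inner matrix_vector_mul_assoc udiag_mult U)
  also have "\<dots> \<le> (\<Sum>i\<in>UNIV. 1 * coord U x i)"
    unfolding quad_udiag
  proof (intro sum_mono mult_right_mono)
    show "e i * e i \<le> 1" for i using e[of i] abs_square_le_1[of "e i"] by (simp add: power2_eq_square)
  qed simp
  finally show ?thesis by (intro power2_le_imp_le[of "norm (udiag U e *v x)"]) (simp_all add: sum_coord U)
qed

lemma inner_udiag_column:
  assumes U: "unitary U" and "e i = 1"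
  shows "column i U \<bullet> (udiag U e *v x) = column i U \<bullet> x"
proof -
  have "column i U \<bullet> (udiag U e *v x) = (udiag U e *v column i U) \<bullet> x"
    by (simp add: hermitian_inner)
  then show ?thesis using assms by (simp add: udiag_column)
qed

lemma trace_log_congruence:
  assumes "posdef C" "posdef B"
  shows "Re (trace (mat_log (C ** B ** C))) = 2 * Re (trace (mat_log C)) + Re (trace (mat_log B))"
  using det_posdef[OF assms(1)] det_posdef[OF assms(2)]
  by (simp add: det_posdef posdef_congruence assms det_mul norm_mult ln_mult_pos)

lemma trace_scaleR: "trace (c *\<^sub>R A) = c *\<^sub>R trace A" for A :: "complex^'n^'n"
  by (simp add: trace_def scaleR_sum_right)

lemma trace_sum: "trace (\<Sum>i\<in>I. f i) = (\<Sum>i\<in>I. trace (f i))" for f :: "'i \<Rightarrow> complex^'n^'n"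
  by (induction I rule: infinite_finite_induct) (auto simp: trace_add, simp_all add: trace_def)

section \<open>Majorization for the Cartan mean\<close>

text \<open>The spectrum of \<open>G\<close> is cut at the smallest eigenvalue \<open>c\<close> belonging to \<open>S\<close>: up to the scalar
  \<open>c\<close>, \<open>G\<close> is the product of a contraction fixing the eigenvectors in \<open>S\<close> and an expansion fixing
  the others. For the expansion the comparison is made on the complement of \<open>S\<close>, and
  carried over to \<open>S\<close> by the multiplicativity of the determinant.\<close>

lemma sum_log_congruence_ge:
  fixes U B :: "complex^'n^'n"
  assumes U: "unitary U" and g: "\<And>i. 0 < g i" and B: "posdef B"
    and S: "S \<noteq> {}" "top_set g S"
  defines "R \<equiv> mat_powr (udiag U g) (1 / 2)"
  shows "(\<Sum>i\<in>S. ln (g i)) + (\<Sum>i\<in>S. column i U \<bullet> (mat_log B *v column i U))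
    \<le> (\<Sum>i\<in>S. column i U \<bullet> (mat_log (R ** B ** R) *v column i U))"
proof -
  define c where "c = Min (g ` S)"
  have cS: "c \<le> g i" if "i \<in> S" for i using that by (simp add: c_def)
  have "c \<in> g ` S" using S by (simp add: c_def)
  then have c0: "0 < c" and cN: "\<And>i. i \<notin> S \<Longrightarrow> g i \<le> c"
    using g S(2) by (auto simp: top_set_def)
  \<comment> \<open>Since max(g, c) min(g, c) = g c, the product c1 c2 is the square root of g / c.
    Here \<open>c1\<close> >= 1 is trivial off \<open>S\<close>, and \<open>c2\<close> <= 1 is
    trivial on \<open>S\<close>.\<close>
  define c1 c2 where "c1 i = sqrt (max (g i) c / c)" and "c2 i = sqrt (min (g i) c / c)" for i
  have c1: "1 \<le> c1 i" and c2: "0 < c2 i" "c2 i \<le> 1" for i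
    using c0 g[of i] by (simp_all add: c1_def c2_def)
  have c1_pos: "0 < c1 i" for i using c1[of i] by linarith
  have c1N: "c1 i = 1" if "i \<notin> S" for i using cN[OF that] c0 by (simp add: c1_def max_def)
  have c2S: "c2 i = 1" if "i \<in> S" for i using cS[OF that] c0 by (simp add: c2_def min_def)
  define C1 C2 D1 where "C1 = udiag U c1" and "C2 = udiag U c2" and "D1 = udiag U (\<lambda>i. 1 / c1 i)"
  have C1: "posdef C1" and C2: "posdef C2" and D1: "posdef D1"
    using c1_pos c2 by (simp_all add: C1_def C2_def D1_def posdef_udiag U)
  have "g i powr (1 / 2) = sqrt c * (c1 i * c2 i)" for i
  proof -
    have "max (g i) c * min (g i) c = g i * c" by (simp add: max_def min_def mult.commute)
    then have "c * (max (g i) c / c * (min (g i) c / c)) = g i" using c0 by (simp add: field_simps)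
    then have "sqrt (g i) = sqrt c * (c1 i * c2 i)"
      unfolding c1_def c2_def by (metis real_sqrt_mult)
    then show ?thesis using g[of i] by (simp add: powr_half_sqrt)
  qed
  then have R1: "R = sqrt c *\<^sub>R (C1 ** C2)"
    by (simp add: R_def mat_powr_udiag U C1_def C2_def udiag_mult udiag_scaleR)
  have comm: "C1 ** C2 = C2 ** C1" by (simp add: C1_def C2_def udiag_mult U mult.commute)
  define B' where "B' = C2 ** B ** C2"
  have B': "posdef B'" unfolding B'_def by (rule posdef_congruence[OF C2 B])
  have CB: "posdef (C1 ** B' ** C1)" by (rule posdef_congruence[OF C1 B'])
  have "R ** B ** R = (sqrt c * sqrt c) *\<^sub>R ((C1 ** C2) ** B ** (C2 ** C1))"
    unfolding R1 mat_mult_scaleR_left mat_mult_scaleR_right scaleR_scaleR by (simp only: comm)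
  also have "\<dots> = c *\<^sub>R (C1 ** B' ** C1)"
    using c0 by (simp add: B'_def matrix_mul_assoc)
  finally have logR: "mat_log (R ** B ** R) = ln c *\<^sub>R mat 1 + mat_log (C1 ** B' ** C1)"
    by (simp add: mat_log_scaleR CB c0)
  \<comment> \<open>The contraction \<open>C2\<close> fixes the columns in \<open>S\<close> and
    pulls the form of \<open>B\<close> back to exactly that of \<open>B'\<close>.\<close>
  have step2: "column i U \<bullet> (mat_log B *v column i U) \<le> column i U \<bullet> (mat_log B' *v column i U)"
    if "i \<in> S" for i
  proof (rule quad_log_mono[OF B B', where C = C2])
    show "norm (C2 *v x) \<le> norm x" for x
      unfolding C2_def using c2 by (intro norm_udiag_le U) (simp add: less_imp_le)
  qed (simp_all add: C2_def inner_udiag_column[where e = c2] U c2S that B'_def quad_congruence)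
  \<comment> \<open>The expansion enters through its inverse: \<open>D1\<close> is a contraction
    that fixes the columns outside \<open>S\<close> and pulls C1 B' C1 back to \<open>B'\<close>.
    Hence the bound is an upper one and lives on the complement.\<close>
  have step1: "column i U \<bullet> (mat_log (C1 ** B' ** C1) *v column i U)
      \<le> column i U \<bullet> (mat_log B' *v column i U)" if "i \<notin> S" for i
  proof (rule quad_log_mono[OF CB B', where C = D1])
    show "norm (D1 *v x) \<le> norm x" for x
      unfolding D1_def using c1 c1_pos by (intro norm_udiag_le U) (simp add: less_imp_le)
    have "C1 *v (D1 *v x) = x" for x
      using c1_pos by (simp add: C1_def D1_def matrix_vector_mul_assoc udiag_mult U
          less_imp_neq[symmetric] udiag_const)
    then show "(D1 *v x) \<bullet> ((C1 ** B' ** C1) *v (D1 *v x)) \<le> x \<bullet> (B' *v x)" for x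
      by (simp add: quad_congruence posdef_hermitian[OF C1])
  qed (simp add: D1_def inner_udiag_column U c1N that)
  define a where "a M i = column i U \<bullet> (mat_log M *v column i U)" for M i
  have split: "sum (a M) S + sum (a M) (-S) = Re (trace (mat_log M))" for M
    using sum_quad_columns[OF U, of "mat_log M"] by (simp add: a_def Compl_eq_Diff_UNIV sum.subset_diff[of S UNIV])
  \<comment> \<open>All of log det C1 sits on \<open>S\<close>, where c1^2 = g / c. Together with
    the upper bound on the complement this yields the lower bound on \<open>S\<close>; the terms ln
    c cancel those in \<open>logR\<close>.\<close>
  have "2 * Re (trace (mat_log C1)) = (\<Sum>i\<in>UNIV. 2 * ln (c1 i))"
    by (simp add: C1_def mat_log_udiag U trace_udiag sum_distrib_left)
  also have "\<dots> = (\<Sum>i\<in>S. 2 * ln (c1 i))"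
    by (rule sum.mono_neutral_right) (auto simp: c1N)
  also have "\<dots> = (\<Sum>i\<in>S. ln (g i) - ln c)"
  proof (rule sum.cong)
    fix i assume "i \<in> S"
    then show "2 * ln (c1 i) = ln (g i) - ln c"
      using cS[of i] c0 g[of i] by (simp add: c1_def max_def ln_sqrt ln_div)
  qed simp
  finally have "Re (trace (mat_log (C1 ** B' ** C1))) =
      (\<Sum>i\<in>S. ln (g i) - ln c) + Re (trace (mat_log B'))"
    by (simp add: trace_log_congruence C1 B')
  moreover have "sum (a (C1 ** B' ** C1)) (-S) \<le> sum (a B') (-S)"
    using step1 by (intro sum_mono) (auto simp: a_def)
  moreover have "sum (a B) S \<le> sum (a B') S"
    using step2 by (intro sum_mono) (auto simp: a_def)
  ultimately have "(\<Sum>i\<in>S. ln (g i) - ln c) + sum (a B) S \<le> sum (a (C1 ** B' ** C1)) S"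
    using split[of B'] split[of "C1 ** B' ** C1"] by linarith
  moreover have "a (R ** B ** R) i = ln c + a (C1 ** B' ** C1) i" for i
    by (simp add: a_def logR matrix_vector_mult_add_rdistrib mat_mult_vec_scaleR inner_add_right
        norm_column U dot_square_norm)
  ultimately show ?thesis unfolding a_def[symmetric] by (simp add: sum_subtractf sum.distrib)
qed

text \<open>Averaging \<open>sum_log_congruence_ge\<close> over j removes the contribution of the
  matrices B_j = G^(-1/2) A_j G^(-1/2), since their logarithms average to 0. What remains is the sum
  of ln g over \<open>S\<close>, bounded by the form of H on eigenvectors of \<open>G\<close>; Ky
  Fan's principle finishes. The trace of the same equation gives equality of the full
  products.\<close>

theorem log_majorized_of_karcher:
  fixes A :: "nat \<Rightarrow> complex^'n^'n"
  assumes A: "\<And>j. j \<in> J \<Longrightarrow> posdef (A j)" and w: "\<And>j. j \<in> J \<Longrightarrow> 0 \<le> w j" "sum w J = 1"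
    and G: "posdef G"
    and eq: "(\<Sum>j\<in>J. w j *\<^sub>R mat_log (mat_powr G (-1/2) ** A j ** mat_powr G (-1/2))) = 0"
  shows "eigvals G \<prec>log eigvals (mat_exp (\<Sum>j\<in>J. w j *\<^sub>R mat_log (A j)))"
proof -
  obtain U g where U: "unitary U" "G = udiag U g" and g: "\<And>i. 0 < g i"
    using posdef_cases[OF G] by blast
  define H where "H = (\<Sum>j\<in>J. w j *\<^sub>R mat_log (A j))"
  have "hermitian H" unfolding hermitian_def H_def ctranspose_sum ctranspose_scaleR
    by (intro sum.cong refl) (simp add: hermitianD hermitian_mat_log A)
  then obtain V h where V: "unitary V" "H = udiag V h" using hermitian_cases by blast
  define B where "B j = mat_powr G (-1/2) ** A j ** mat_powr G (-1/2)" for j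
  have B: "posdef (B j)" if "j \<in> J" for j
    unfolding B_def by (intro posdef_congruence posdef_mat_powr G A that)
  have AB: "A j = mat_powr G (1/2) ** B j ** mat_powr G (1/2)" for j
    unfolding B_def using mat_powr_half_inverse[OF G] by (metis matrix_mul_assoc matrix_mul_lid matrix_mul_rid)
  have zero: "(\<Sum>j\<in>J. w j *\<^sub>R mat_log (B j)) = 0" using eq by (simp add: B_def)
  have logsum: "(\<Sum>i\<in>S. ln (g i)) \<le> sum h T"
    if S: "card S = card T" "S \<noteq> {}" "top_set g S" "top_set h T" for S T
  proof -
    define q where "q M = (\<Sum>i\<in>S. column i U \<bullet> (M *v column i U))" for M
    have q_lin: "q (\<Sum>j\<in>J. w j *\<^sub>R M j) = (\<Sum>j\<in>J. w j * q (M j))" for M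
      unfolding q_def sum_mat_mult_vec mat_mult_vec_scaleR inner_sum_right inner_scaleR_right sum_distrib_left
      by (rule sum.swap)
    have "(\<Sum>i\<in>S. ln (g i)) + q (mat_log (B j)) \<le> q (mat_log (A j))" if "j \<in> J" for j
      unfolding q_def AB[of j] U(2) using U g B[OF that] S
      by (intro sum_log_congruence_ge)
    then have "(\<Sum>j\<in>J. w j * ((\<Sum>i\<in>S. ln (g i)) + q (mat_log (B j)))) \<le> (\<Sum>j\<in>J. w j * q (mat_log (A j)))"
      using w by (intro sum_mono mult_left_mono)
    moreover have "(\<Sum>j\<in>J. w j * q (mat_log (B j))) = 0"
      unfolding q_lin[symmetric] zero by (simp add: q_def)
    ultimately have "(\<Sum>i\<in>S. ln (g i)) \<le> q H"
      by (simp add: H_def q_lin distrib_left sum.distrib sum_distrib_right[symmetric] w)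
    also have "\<dots> \<le> sum h T"
      unfolding q_def V(2) by (rule ky_fan_maximum[OF U(1) V(1) S(1,4)])
    finally show ?thesis .
  qed
  have top_exp: "top_set (\<lambda>i. exp (h i)) T = top_set h T" for T by (simp add: top_set_def)
  have prod_exp: "prod g S = exp (\<Sum>i\<in>S. ln (g i))" "prod (\<lambda>i. exp (h i)) S = exp (sum h S)" for S
    using g by (simp_all add: exp_sum)
  have "eigvals (udiag U g) \<prec>wlog eigvals (udiag V (\<lambda>i. exp (h i)))"
    using logsum by (intro wlog_majorizedI U V) (simp add: prod_exp top_exp)
  moreover have "(\<Sum>i\<in>UNIV. ln (g i)) = sum h UNIV"
  proof -
    have "Re (trace (mat_log (A j))) = Re (trace (mat_log G)) + Re (trace (mat_log (B j)))" if "j \<in> J" for j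
      unfolding AB[of j] by (subst trace_log_congruence) (simp_all add: posdef_mat_powr G B that mat_log_powr trace_scaleR)
    then have "(\<Sum>j\<in>J. w j * Re (trace (mat_log (A j)))) =
        Re (trace (mat_log G)) + Re (trace (\<Sum>j\<in>J. w j *\<^sub>R mat_log (B j)))"
      by (simp add: distrib_left sum.distrib sum_distrib_right[symmetric] w trace_sum trace_scaleR)
    moreover have "(\<Sum>j\<in>J. w j * Re (trace (mat_log (A j)))) = Re (trace H)"
      by (simp add: H_def trace_sum trace_scaleR)
    ultimately have "Re (trace H) = Re (trace (mat_log G))" by (simp add: zero trace_def)
    then show ?thesis by (simp add: U V mat_log_udiag trace_udiag)
  qed
  then have "prod g UNIV = prod (\<lambda>i. exp (h i)) UNIV" by (simp only: prod_exp)
  ultimately show ?thesis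
    unfolding log_majorized_def H_def[symmetric] V(2) U(2)
    by (simp add: mat_exp_udiag prod_list_eigvals U(1) V(1))
qed

section \<open>The Riccati equation \<open>T P T = A\<close>\<close>

text \<open>Operator monotonicity of the square root. If S - T had an eigenvector v with eigenvalue
  \<delta> < 0, the difference of the squared norms of S v and T v would be \<delta> times the
  positive form of S + T at v.\<close>

lemma square_mono_imp_mono:
  assumes S: "posdef S" and T: "posdef T" and le: "\<And>x. norm (T *v x) \<le> norm (S *v x)"
  shows "x \<bullet> (T *v x) \<le> x \<bullet> (S *v x)"
proof -
  have "hermitian (S - T)" using S T by (simp add: posdef_def hermitian_def ctranspose_diff)
  then obtain W \<delta> where W: "unitary W" and ST: "S - T = udiag W \<delta>" using hermitian_cases by blast
  have "0 \<le> \<delta> i" for i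
  proof (rule ccontr)
    define v where "v = column i W"
    assume "\<not> 0 \<le> \<delta> i"
    have Sv: "S *v v - T *v v = \<delta> i *\<^sub>R v"
      by (simp add: v_def udiag_column[OF W] matrix_vector_mult_diff_rdistrib[symmetric] ST)
    have "0 \<le> (norm (S *v v))\<^sup>2 - (norm (T *v v))\<^sup>2" using le[of v] by (simp add: power_mono)
    also have "\<dots> = (S *v v - T *v v) \<bullet> (S *v v + T *v v)"
      by (simp add: power2_norm_eq_inner inner_diff_left inner_diff_right inner_add_left inner_add_right
          inner_commute[of "T *v v" "S *v v"])
    also have "\<dots> = \<delta> i * (v \<bullet> (S *v v) + v \<bullet> (T *v v))"
      by (simp add: Sv inner_add_right distrib_left)
    also have "\<dots> < 0" using \<open>\<not> 0 \<le> \<delta> i\<close> posdef_pos[OF S, of v] posdef_pos[OF T, of v] column_nonzero[OF W]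
      by (intro mult_neg_pos) (auto simp: v_def)
    finally show False by simp
  qed
  then have "0 \<le> x \<bullet> ((S - T) *v x)" by (simp add: ST quad_udiag sum_nonneg)
  then show ?thesis by (simp add: matrix_vector_mult_diff_rdistrib inner_diff_right)
qed

text \<open>With R = P^(1/2), the square of R Z R is R (Z P Z) R. So the hypothesis compares the
  squares of R Y R and R X R, and the congruence by R can be undone.\<close>

lemma riccati_mono:
  assumes P: "posdef P" and X: "posdef X" and Y: "posdef Y"
    and le: "\<And>x. x \<bullet> ((Y ** P ** Y) *v x) \<le> x \<bullet> ((X ** P ** X) *v x)"
  shows "x \<bullet> (Y *v x) \<le> x \<bullet> (X *v x)"
proof -
  define R K where "R = mat_powr P (1/2)" and "K = mat_powr P (-1/2)"
  have R: "posdef R" and RR: "R ** R = P"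
    by (simp_all add: R_def P posdef_mat_powr mat_powr_half_square)
  have RK: "R ** K = mat 1" unfolding R_def K_def by (rule mat_powr_half_inverse[OF P])
  have nrm: "(norm ((R ** Z ** R) *v x))\<^sup>2 = (R *v x) \<bullet> ((Z ** P ** Z) *v (R *v x))" if "posdef Z" for Z x
  proof -
    have "(norm ((R ** Z ** R) *v x))\<^sup>2 = x \<bullet> ((R ** Z ** R) *v ((R ** Z ** R) *v x))"
      by (simp add: power2_norm_eq_inner hermitian_inner hermitian_congruence posdef_hermitian R that)
    also have "\<dots> = x \<bullet> (R *v ((Z ** (R ** R) ** Z) *v (R *v x)))"
      by (simp add: matrix_vector_mul_assoc matrix_mul_assoc)
    finally show ?thesis unfolding RR by (simp add: hermitian_inner posdef_hermitian R)
  qed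
  have "norm ((R ** Y ** R) *v z) \<le> norm ((R ** X ** R) *v z)" for z
    by (rule power2_le_imp_le) (simp_all add: nrm X Y le)
  then have "(K *v x) \<bullet> ((R ** Y ** R) *v (K *v x)) \<le> (K *v x) \<bullet> ((R ** X ** R) *v (K *v x))"
    by (intro square_mono_imp_mono posdef_congruence R X Y)
  then show ?thesis
    by (simp add: quad_congruence posdef_hermitian R matrix_vector_mul_assoc[of R K] RK)
qed

text \<open>The geometric mean of P^(-1) and A; equivalently, the optimal transport map between
  centered Gaussians with covariances P and A.\<close>

definition riccati :: "complex^'n^'n \<Rightarrow> complex^'n^'n \<Rightarrow> complex^'n^'n" where
  "riccati P A = mat_powr P (-1/2) ** mat_powr (mat_powr P (1/2) ** A ** mat_powr P (1/2)) (1/2) ** mat_powr P (-1/2)"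

lemma riccati:
  assumes P: "posdef P" and A: "posdef A"
  shows "posdef (riccati P A)" "riccati P A ** P ** riccati P A = A"
proof -
  define R K M where "R = mat_powr P (1/2)" and "K = mat_powr P (-1/2)" and "M = mat_powr (R ** A ** R) (1/2)"
  have R: "posdef R" and K: "posdef K" and RR: "R ** R = P"
    by (simp_all add: R_def K_def P posdef_mat_powr mat_powr_half_square)
  have RK: "R ** K = mat 1" "K ** R = mat 1" unfolding R_def K_def by (rule mat_powr_half_inverse[OF P])+
  have M: "posdef M" "M ** M = R ** A ** R"
    by (simp_all add: M_def posdef_mat_powr posdef_congruence mat_powr_half_square R A)
  have ric: "riccati P A = K ** M ** K" by (simp add: riccati_def R_def K_def M_def)
  show "posdef (riccati P A)" unfolding ric by (intro posdef_congruence K M)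
  have "riccati P A ** P ** riccati P A = K ** M ** (K ** R) ** (R ** K) ** M ** K"
    unfolding ric by (simp add: RR[symmetric] matrix_mul_assoc)
  also have "\<dots> = K ** (M ** M) ** K" unfolding RK by (simp add: matrix_mul_assoc)
  also have "\<dots> = (K ** R) ** A ** (R ** K)" unfolding M by (simp only: matrix_mul_assoc)
  finally show "riccati P A ** P ** riccati P A = A" unfolding RK by simp
qed

section \<open>Majorization for the Wasserstein mean\<close>

lemma quad_log_mono_order:
  assumes "posdef B" "posdef M" "\<And>x. x \<bullet> (B *v x) \<le> x \<bullet> (M *v x)"
  shows "v \<bullet> (mat_log B *v v) \<le> v \<bullet> (mat_log M *v v)"
  by (rule quad_log_mono[OF assms(1,2), where C = "mat 1"]) (simp_all add: assms(3))

text \<open>As for the Cartan mean, with \<open>O\<close> replaced by its truncation \<open>O2 \<ge> O\<close> from below at the smallest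
  eigenvalue \<open>c\<close> in \<open>K\<close>. The solution \<open>Y\<close> of \<open>Y O2 Y = A\<close> satisfies \<open>Y \<le> T\<close> and, since \<open>O2 \<ge> c\<close>, also
  \<open>Y \<le> (A / c)^(1/2)\<close>.\<close>

lemma sum_log_riccati_ge:
  fixes U V T A :: "complex^'n^'n"
  assumes U: "unitary U" and om: "\<And>i. 0 < om i" and V: "unitary V" and T: "posdef T" and A: "posdef A"
    and TA: "T ** udiag U om ** T = A"
    and K: "K \<noteq> {}" "top_set om K" and card: "card S = card K"
  shows "(\<Sum>i\<in>S. column i V \<bullet> (mat_log A *v column i V))
    \<le> 2 * (\<Sum>i\<in>S. column i V \<bullet> (mat_log T *v column i V)) + (\<Sum>i\<in>K. ln (om i))"
proof -
  define c where "c = Min (om ` K)"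
  have cK: "c \<le> om i" if "i \<in> K" for i using that by (simp add: c_def)
  have "c \<in> om ` K" using K by (simp add: c_def)
  then have c0: "0 < c" and cN: "\<And>i. i \<notin> K \<Longrightarrow> om i \<le> c"
    using om K(2) by (auto simp: top_set_def)
  define O1 O2 where "O1 = udiag U om" and "O2 = udiag U (\<lambda>i. max (om i) c)"
  have O1: "posdef O1" and O2: "posdef O2" using om c0 by (simp_all add: O1_def O2_def posdef_udiag U less_max_iff_disj)
  have O12: "x \<bullet> (O1 *v x) \<le> x \<bullet> (O2 *v x)" for x
    unfolding O1_def O2_def quad_udiag by (intro sum_mono mult_right_mono) auto
  define cI where "cI = udiag U (\<lambda>_. c)"
  have cI: "posdef cI" using c0 by (simp add: cI_def posdef_udiag U)
  have cO2: "x \<bullet> (cI *v x) \<le> x \<bullet> (O2 *v x)" for x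
    unfolding cI_def O2_def quad_udiag by (intro sum_mono mult_right_mono) auto
  define Y where "Y = riccati O2 A"
  have Y: "posdef Y" and YA: "Y ** O2 ** Y = A" by (simp_all add: Y_def riccati O2 A)
  define Z where "Z = mat_powr ((1 / c) *\<^sub>R A) (1/2)"
  have Ac: "posdef ((1 / c) *\<^sub>R A)" using A c0 by (simp add: posdef_scaleR)
  have Z: "posdef Z" "Z ** Z = (1 / c) *\<^sub>R A" by (simp_all add: Z_def posdef_mat_powr mat_powr_half_square Ac)
  have ZA: "Z ** cI ** Z = A"
    using c0 by (simp add: cI_def udiag_const U mat_mult_scaleR_left mat_mult_scaleR_right Z)
  \<comment> \<open>Y O1 Y <= Y O2 Y = A = T O1 T, so both sides are Riccati expressions for the
    same matrix \<open>O1\<close>.\<close>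
  have YT: "x \<bullet> (Y *v x) \<le> x \<bullet> (T *v x)" for x
  proof (rule riccati_mono[OF O1 T Y])
    show "x \<bullet> ((Y ** O1 ** Y) *v x) \<le> x \<bullet> ((T ** O1 ** T) *v x)" for x
      using O12[of "Y *v x"] TA YA quad_congruence[OF posdef_hermitian[OF Y], of x O1]
        quad_congruence[OF posdef_hermitian[OF Y], of x O2] by (simp add: O1_def[symmetric])
  qed
  have YZ: "x \<bullet> (Y *v x) \<le> x \<bullet> (Z *v x)" for x
  proof (rule riccati_mono[OF cI Z(1) Y])
    show "x \<bullet> ((Y ** cI ** Y) *v x) \<le> x \<bullet> ((Z ** cI ** Z) *v x)" for x
      using cO2[of "Y *v x"] ZA YA quad_congruence[OF posdef_hermitian[OF Y], of x cI]
        quad_congruence[OF posdef_hermitian[OF Y], of x O2] by simp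
  qed
  define a where "a M i = column i V \<bullet> (mat_log M *v column i V)" for M i
  have split: "sum (a M) S + sum (a M) (-S) = Re (trace (mat_log M))" for M
    using sum_quad_columns[OF V, of "mat_log M"] by (simp add: a_def Compl_eq_Diff_UNIV sum.subset_diff[of S UNIV])
  \<comment> \<open>On \<open>S\<close> the auxiliary solution is compared with \<open>T\<close>,
    off \<open>S\<close> with \<open>Z\<close>. The identity log det A = 2 log det Y + log det O2
    then joins the two estimates.\<close>
  have aYT: "sum (a Y) S \<le> sum (a T) S"
    unfolding a_def by (intro sum_mono quad_log_mono_order Y T YT)
  have "a Z i = (a A i - ln c) / 2" for i
    using c0 by (simp add: a_def Z_def mat_log_powr Ac mat_log_scaleR A mat_mult_vec_scaleR
        matrix_vector_mult_add_rdistrib matrix_vector_mult_diff_rdistrib inner_add_right inner_diff_right ln_div dot_square_norm norm_column V)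
  moreover have "a Y i \<le> a Z i" for i
    unfolding a_def by (rule quad_log_mono_order[OF Y Z(1) YZ])
  ultimately have "sum (a Y) (-S) \<le> (\<Sum>i\<in>-S. (a A i - ln c) / 2)"
    by (intro sum_mono) metis
  then have aYN: "2 * sum (a Y) (-S) \<le> sum (a A) (-S) - card (-S) * ln c"
    by (simp add: sum_divide_distrib[symmetric] sum_subtractf)
  have "Re (trace (mat_log O2)) = (\<Sum>i\<in>UNIV. ln (max (om i) c))"
    by (simp add: O2_def mat_log_udiag U trace_udiag)
  also have "\<dots> = (\<Sum>i\<in>K. ln (max (om i) c)) + (\<Sum>i\<in>-K. ln (max (om i) c))"
    by (simp add: Compl_eq_Diff_UNIV sum.subset_diff[of K UNIV])
  also have "(\<Sum>i\<in>K. ln (max (om i) c)) = (\<Sum>i\<in>K. ln (om i))"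
    using cK by (intro sum.cong) (auto simp: max_absorb1)
  also have "(\<Sum>i\<in>-K. ln (max (om i) c)) = (\<Sum>i\<in>-K. ln c)"
    using cN by (intro sum.cong) (auto simp: max_absorb2)
  \<comment> \<open>\<open>S\<close> and \<open>K\<close> index different bases and share only their
    size. Equal complements in number make these copies of ln c cancel the ones in
    \<open>aYN\<close>.\<close>
  finally have "Re (trace (mat_log O2)) = (\<Sum>i\<in>K. ln (om i)) + card (-S) * ln c"
    using card by (simp add: Compl_eq_Diff_UNIV card_Diff_subset)
  moreover have "Re (trace (mat_log A)) = 2 * Re (trace (mat_log Y)) + Re (trace (mat_log O2))"
    using trace_log_congruence[OF Y O2] by (simp add: YA)
  ultimately have "sum (a A) S \<le> 2 * sum (a T) S + (\<Sum>i\<in>K. ln (om i))"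
    using split[of A] split[of Y] aYT aYN by linarith
  then show ?thesis by (simp add: a_def)
qed

lemma quad_log_le:
  assumes "posdef T"
  shows "v \<bullet> (mat_log T *v v) \<le> v \<bullet> (T *v v) - v \<bullet> v"
  using assms
proof (rule posdef_cases)
  fix U d assume U: "unitary U" "T = udiag U d" and d: "\<And>i. 0 < d i"
  have "v \<bullet> (mat_log T *v v) \<le> (\<Sum>i\<in>UNIV. (d i - 1) * coord U v i)"
    unfolding U(2) mat_log_udiag[OF U(1)] quad_udiag
    by (intro sum_mono mult_right_mono ln_le_minus_one d) auto
  also have "\<dots> = v \<bullet> (T *v v) - v \<bullet> v"
    by (simp add: U quad_udiag left_diff_distrib sum_subtractf sum_coord power2_norm_eq_inner)
  finally show ?thesis .
qed

text \<open>The test vectors are eigenvectors of H itself, so the left side is the exact sum of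
  \<open>h\<close> over \<open>S\<close>. The logarithms of the T_j are bounded by T_j - I, which
  averages to 0, and only the eigenvalues of \<open>Om\<close> remain.\<close>

theorem wlog_majorized_of_riccati:
  fixes A :: "nat \<Rightarrow> complex^'n^'n"
  assumes A: "\<And>j. j \<in> J \<Longrightarrow> posdef (A j)" and w: "\<And>j. j \<in> J \<Longrightarrow> 0 \<le> w j" "sum w J = 1"
    and Om: "posdef Om" and T: "\<And>j. j \<in> J \<Longrightarrow> posdef (T j)" "\<And>j. j \<in> J \<Longrightarrow> T j ** Om ** T j = A j"
    and eq: "(\<Sum>j\<in>J. w j *\<^sub>R T j) = mat 1"
  shows "eigvals (mat_exp (\<Sum>j\<in>J. w j *\<^sub>R mat_log (A j))) \<prec>wlog eigvals Om"
proof -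
  obtain U om where U: "unitary U" "Om = udiag U om" and om: "\<And>i. 0 < om i"
    using posdef_cases[OF Om] by blast
  define H where "H = (\<Sum>j\<in>J. w j *\<^sub>R mat_log (A j))"
  have "hermitian H" unfolding hermitian_def H_def ctranspose_sum ctranspose_scaleR
    by (intro sum.cong refl) (simp add: hermitianD hermitian_mat_log A)
  then obtain V h where V: "unitary V" "H = udiag V h" using hermitian_cases by blast
  have logsum: "sum h S \<le> (\<Sum>i\<in>K. ln (om i))"
    if S: "card S = card K" "S \<noteq> {}" "top_set om K" for S K
  proof -
    define q where "q M = (\<Sum>i\<in>S. column i V \<bullet> (M *v column i V))" for M
    have q_lin: "q (\<Sum>j\<in>J. w j *\<^sub>R M j) = (\<Sum>j\<in>J. w j * q (M j))" for M
      unfolding q_def sum_mat_mult_vec mat_mult_vec_scaleR inner_sum_right inner_scaleR_right sum_distrib_left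
      by (rule sum.swap)
    have "K \<noteq> {}" using S by auto
    then have "q (mat_log (A j)) \<le> 2 * q (mat_log (T j)) + (\<Sum>i\<in>K. ln (om i))" if "j \<in> J" for j
      unfolding q_def using S T(2)[OF that, unfolded U(2)]
      by (intro sum_log_riccati_ge[OF U(1) om V(1) T(1) A]) (simp_all add: that)
    moreover have "q (mat_log (T j)) \<le> q (T j) - q (mat 1)" if "j \<in> J" for j
      unfolding q_def sum_subtractf[symmetric] using quad_log_le[OF T(1)[OF that]]
      by (intro sum_mono) simp
    ultimately have "q (mat_log (A j)) \<le> 2 * (q (T j) - q (mat 1)) + (\<Sum>i\<in>K. ln (om i))" if "j \<in> J" for j
      using that by fastforce
    then have "(\<Sum>j\<in>J. w j * q (mat_log (A j)))
        \<le> (\<Sum>j\<in>J. w j * (2 * (q (T j) - q (mat 1)) + (\<Sum>i\<in>K. ln (om i))))"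
      using w by (intro sum_mono mult_left_mono)
    also have "\<dots> = 2 * ((\<Sum>j\<in>J. w j * q (T j)) - q (mat 1)) + (\<Sum>i\<in>K. ln (om i))"
      by (simp add: distrib_left right_diff_distrib sum.distrib sum_subtractf sum_distrib_left[symmetric]
          sum_distrib_right[symmetric] w mult.left_commute[of _ 2])
    also have "(\<Sum>j\<in>J. w j * q (T j)) = q (mat 1)" by (simp add: q_lin[symmetric] eq)
    finally have "q H \<le> (\<Sum>i\<in>K. ln (om i))" by (simp add: H_def q_lin)
    moreover have "q H = sum h S" by (simp add: q_def V quad_udiag_column)
    ultimately show ?thesis by simp
  qed
  have prod_exp: "prod om S = exp (\<Sum>i\<in>S. ln (om i))" "prod (\<lambda>i. exp (h i)) S = exp (sum h S)" for S
    using om by (simp_all add: exp_sum)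
  have "eigvals (udiag V (\<lambda>i. exp (h i))) \<prec>wlog eigvals (udiag U om)"
    using logsum by (intro wlog_majorizedI U V) (simp add: prod_exp)
  then show ?thesis by (simp add: H_def[symmetric] U V mat_exp_udiag)
qed

section \<open>Hermitian matrices with spectrum in an interval\<close>

text \<open>Formulated with quadratic forms rather than eigenvalues, which makes closedness,
  convexity and the effect of congruences direct.\<close>

definition spec_between :: "real \<Rightarrow> real \<Rightarrow> (complex^'n^'n) set" where
  "spec_between a b = {C. hermitian C \<and> (\<forall>x. a * (norm x)\<^sup>2 \<le> x \<bullet> (C *v x) \<and> x \<bullet> (C *v x) \<le> b * (norm x)\<^sup>2)}"

lemma udiag_spec_between:
  assumes U: "unitary U"
  shows "udiag U d \<in> spec_between a b \<longleftrightarrow> (\<forall>i. a \<le> d i \<and> d i \<le> b)"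
proof
  assume "udiag U d \<in> spec_between a b"
  then show "\<forall>i. a \<le> d i \<and> d i \<le> b"
    unfolding spec_between_def using quad_udiag_column[OF U, of _ d] norm_column[OF U]
    by (metis (mono_tags, lifting) mem_Collect_eq mult.right_neutral one_power2)
next
  assume d: "\<forall>i. a \<le> d i \<and> d i \<le> b"
  show "udiag U d \<in> spec_between a b"
    unfolding spec_between_def quad_udiag sum_coord[OF U, symmetric] sum_distrib_left
    using d by (auto intro!: sum_mono mult_right_mono simp: quad_udiag)
qed

lemma spec_between_cases:
  assumes "C \<in> spec_between a b"
  obtains U d where "unitary U" "C = udiag U d" "\<And>i. a \<le> d i" "\<And>i. d i \<le> b"
proof -
  obtain U d where U: "unitary U" "C = udiag U d"
    using assms by (auto simp: spec_between_def elim: hermitian_cases)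
  with assms that show thesis by (simp add: udiag_spec_between)
qed

lemma spec_between_posdef: "C \<in> spec_between a b \<Longrightarrow> 0 < a \<Longrightarrow> posdef C"
  by (elim spec_between_cases) (auto simp: posdef_udiag intro: less_le_trans)

lemma hermitian_spec_between:
  assumes "hermitian C"
  obtains l where "0 \<le> l" "C \<in> spec_between (-l) l"
proof -
  obtain U d where U: "unitary U" "C = udiag U d" using hermitian_cases[OF assms] by blast
  have "\<bar>d i\<bar> \<le> (\<Sum>i\<in>UNIV. \<bar>d i\<bar>)" for i by (rule member_le_sum) auto
  then show thesis
    by (intro that[of "\<Sum>i\<in>UNIV. \<bar>d i\<bar>"])
      (auto simp: U udiag_spec_between sum_nonneg abs_le_iff minus_le_iff)
qed

lemma posdef_spec_between:
  assumes "posdef C"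
  obtains a b where "0 < a" "a \<le> b" "C \<in> spec_between a b"
proof -
  obtain U d where U: "unitary U" "C = udiag U d" "\<And>i. 0 < d i" using posdef_cases[OF assms] by blast
  have "Min (range d) \<in> range d" by (rule Min_in) auto
  then have pos: "0 < Min (range d)" using U(3) by auto
  have le: "Min (range d) \<le> d i" "d i \<le> Max (range d)" for i by auto
  then have "Min (range d) \<le> Max (range d)" by (meson order_trans)
  with pos le show thesis
    by (intro that[of "Min (range d)" "Max (range d)"]) (simp_all only: U udiag_spec_between, auto)
qed

lemma spec_between_mono:
  assumes "C \<in> spec_between a b" "a' \<le> a" "b \<le> b'"
  shows "C \<in> spec_between a' b'"
  using assms(1)
  by (rule spec_between_cases) (use assms in \<open>auto simp: udiag_spec_between intro: order_trans\<close>)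

lemma spec_between_norm:
  assumes "C \<in> spec_between a b" "0 \<le> a"
  shows "a * norm x \<le> norm (C *v x)" "norm (C *v x) \<le> b * norm x"
proof -
  obtain U d where U: "unitary U" "C = udiag U d" and d: "\<And>i. a \<le> d i" "\<And>i. d i \<le> b"
    using spec_between_cases[OF assms(1)] by blast
  have b: "0 \<le> b" using d assms(2) by (meson order_trans)
  have eq: "(norm (C *v x))\<^sup>2 = (\<Sum>i\<in>UNIV. (d i)\<^sup>2 * coord U x i)"
    unfolding U(2) power2_norm_eq_inner
    by (simp add: hermitian_inner matrix_vector_mul_assoc udiag_mult U(1) quad_udiag power2_eq_square)
  have "(a * norm x)\<^sup>2 \<le> (norm (C *v x))\<^sup>2"
    unfolding eq power_mult_distrib sum_coord[OF U(1), of x, symmetric] sum_distrib_left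
    using d assms(2) by (intro sum_mono mult_right_mono power_mono) auto
  then show "a * norm x \<le> norm (C *v x)" by (rule power2_le_imp_le) simp
  have "0 \<le> d i" for i using d(1)[of i] assms(2) by linarith
  then have "(norm (C *v x))\<^sup>2 \<le> (b * norm x)\<^sup>2"
    unfolding eq power_mult_distrib sum_coord[OF U(1), of x, symmetric] sum_distrib_left
    using d by (intro sum_mono mult_right_mono power_mono) auto
  then show "norm (C *v x) \<le> b * norm x" by (rule power2_le_imp_le) (simp add: b)
qed

lemma spec_between_congruence:
  assumes C: "C \<in> spec_between \<alpha> \<beta>" "0 \<le> \<alpha>" and A: "A \<in> spec_between a b" "0 \<le> a" "0 \<le> b"
  shows "C ** A ** C \<in> spec_between (a * \<alpha>\<^sup>2) (b * \<beta>\<^sup>2)"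
proof -
  have hC: "hermitian C" and hA: "hermitian A" using C A by (auto simp: spec_between_def)
  have "a * \<alpha>\<^sup>2 * (norm x)\<^sup>2 \<le> (C *v x) \<bullet> (A *v (C *v x)) \<and> (C *v x) \<bullet> (A *v (C *v x)) \<le> b * \<beta>\<^sup>2 * (norm x)\<^sup>2" for x
  proof -
    have "a * (norm (C *v x))\<^sup>2 \<le> (C *v x) \<bullet> (A *v (C *v x))"
      "(C *v x) \<bullet> (A *v (C *v x)) \<le> b * (norm (C *v x))\<^sup>2"
      using A(1) by (auto simp: spec_between_def)
    moreover have "a * (\<alpha> * norm x)\<^sup>2 \<le> a * (norm (C *v x))\<^sup>2" "b * (norm (C *v x))\<^sup>2 \<le> b * (\<beta> * norm x)\<^sup>2"
      using spec_between_norm[OF C, of x] C(2) A by (auto intro!: mult_left_mono power_mono)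
    ultimately show ?thesis by (simp add: power_mult_distrib mult.assoc)
  qed
  then show ?thesis
    by (simp add: spec_between_def hermitian_congruence hC hA quad_congruence)
qed

lemma norm_udiag: "unitary U \<Longrightarrow> (norm (udiag U d))\<^sup>2 = (\<Sum>i\<in>UNIV. (d i)\<^sup>2)"
  unfolding power2_norm_eq_inner inner_matrix
  by (simp add: hermitianD udiag_mult trace_udiag power2_eq_square)

lemma continuous_on_ctranspose [continuous_intros]:
  "continuous_on S f \<Longrightarrow> continuous_on S (\<lambda>x. ctranspose (f x))"
  unfolding ctranspose_def by (intro continuous_intros)

lemma continuous_on_mat_mult [continuous_intros]:
  fixes f :: "'a::topological_space \<Rightarrow> complex^'n^'m" and g :: "'a \<Rightarrow> complex^'k^'n"
  assumes "continuous_on S f" "continuous_on S g"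
  shows "continuous_on S (\<lambda>x. f x ** g x)"
  unfolding matrix_matrix_mult_def using assms by (intro continuous_intros)

lemma compact_spec_between: "compact (spec_between a b :: (complex^'n^'n) set)"
proof -
  have q: "continuous_on UNIV (\<lambda>C :: complex^'n^'n. x \<bullet> (C *v x))" for x
    unfolding matrix_vector_mult_def by (intro continuous_intros)
  have eq: "spec_between a b = {C :: complex^'n^'n. ctranspose C = C} \<inter>
      (\<Inter>x. {C. a * (norm x)\<^sup>2 \<le> x \<bullet> (C *v x)} \<inter> {C. x \<bullet> (C *v x) \<le> b * (norm x)\<^sup>2})"
    by (auto simp: spec_between_def hermitian_def)
  have "closed (spec_between a b :: (complex^'n^'n) set)"
    unfolding eq by (intro closed_Int closed_INT ballI closed_Collect_eq closed_Collect_le continuous_intros q)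
  moreover have "norm C \<le> sqrt (\<Sum>i\<in>(UNIV::'n set). (\<bar>a\<bar> + \<bar>b\<bar>)\<^sup>2)" if C: "C \<in> spec_between a b" for C :: "complex^'n^'n"
  proof (rule real_le_rsqrt)
    obtain U d where U: "unitary U" "C = udiag U d" and d: "\<And>i. a \<le> d i" "\<And>i. d i \<le> b"
      using spec_between_cases[OF C] by blast
    have "\<bar>d i\<bar> \<le> \<bar>\<bar>a\<bar> + \<bar>b\<bar>\<bar>" for i using d[of i] by linarith
    then show "(norm C)\<^sup>2 \<le> (\<Sum>i\<in>(UNIV::'n set). (\<bar>a\<bar> + \<bar>b\<bar>)\<^sup>2)"
      unfolding U(2) norm_udiag[OF U(1)] by (intro sum_mono) (simp only: abs_le_square_iff)
  qed
  then have "bounded (spec_between a b :: (complex^'n^'n) set)" by (auto simp: bounded_iff)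
  ultimately show ?thesis by (simp add: compact_eq_bounded_closed)
qed

lemma inner_columns: "X \<bullet> Y = (\<Sum>j\<in>UNIV. column j X \<bullet> column j Y)" for X Y :: "complex^'m^'n"
  unfolding inner_vec_def column_def by simp (rule sum.swap)

lemma inner_posdef_mult_pos:
  assumes "posdef W" "X \<noteq> 0"
  shows "0 < X \<bullet> (W ** X)"
proof -
  obtain i j where "X $ i $ j \<noteq> 0" using assms(2) by (auto simp: vec_eq_iff)
  then have "column j X \<noteq> 0" by (auto simp: column_def vec_eq_iff)
  then show ?thesis unfolding inner_columns column_mult using assms(1)
    by (intro sum_pos2[of _ j]) (auto simp: posdef_pos posdef_nonneg)
qed

section \<open>The derivative of the squared distance to the identity\<close>

text \<open>The squared Cartan distance from \<open>C\<close> to the identity; the distance from X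
  to A is obtained at C = X^(-1/2) A X^(-1/2).\<close>

definition log_norm2 :: "complex^'n^'n \<Rightarrow> real" where
  "log_norm2 C = (norm (mat_log C))\<^sup>2"

lemma log_norm2_udiag: "unitary U \<Longrightarrow> log_norm2 (udiag U d) = (\<Sum>i\<in>UNIV. (ln (d i))\<^sup>2)"
  by (simp add: log_norm2_def mat_log_udiag norm_udiag)

text \<open>With L = ln x - ln y and its linearization D, the remainder is L^2 + 2 ln y (L - D). The
  first term accounts for the 1 in the constant, the second for 2 (|ln a| + |ln b|); tangent bounds
  for ln at both points supply the factor 1 / a^2.\<close>

lemma ln_square_taylor:
  fixes a b x y :: real
  assumes a: "0 < a" and x: "a \<le> x" "x \<le> b" and y: "a \<le> y" "y \<le> b"
  shows "\<bar>(ln x)\<^sup>2 - (ln y)\<^sup>2 - 2 * (ln y / y) * (x - y)\<bar> \<le> (1 + 2 * (\<bar>ln a\<bar> + \<bar>ln b\<bar>)) / a\<^sup>2 * (x - y)\<^sup>2"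
proof -
  define L D where "L = ln x - ln y" and "D = (x - y) / y"
  have pos: "0 < x" "0 < y" using a x y by auto
  have up: "ln x - ln y \<le> (x - y) / y" and lo: "ln y - ln x \<le> (y - x) / x"
    using pos by (simp_all add: ln_diff_le)
  have "(x - y) / y - (ln x - ln y) \<le> (x - y) / y + (y - x) / x" using lo by linarith
  also have "\<dots> = (x - y)\<^sup>2 / (x * y)" using pos by (simp add: field_simps power2_eq_square)
  also have "\<dots> \<le> (x - y)\<^sup>2 / (a * a)" using a x y by (intro divide_left_mono mult_mono) auto
  finally have LD: "\<bar>L - D\<bar> \<le> (x - y)\<^sup>2 / a\<^sup>2" using up by (simp add: L_def D_def power2_eq_square)
  have "\<bar>L\<bar> \<le> \<bar>x - y\<bar> / a"
  proof -
    have "(x - y) / y \<le> \<bar>x - y\<bar> / a" "(y - x) / x \<le> \<bar>x - y\<bar> / a"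
      using a x y by (auto intro!: frac_le)
    then show ?thesis using up lo by (simp add: L_def)
  qed
  then have "L\<^sup>2 \<le> (\<bar>x - y\<bar> / a)\<^sup>2" by (metis abs_ge_zero power2_abs power_mono)
  then have L2: "L\<^sup>2 \<le> (x - y)\<^sup>2 / a\<^sup>2" by (simp add: power_divide)
  have "ln a \<le> ln y" "ln y \<le> ln b" using a y by auto
  then have ly: "\<bar>ln y\<bar> \<le> \<bar>ln a\<bar> + \<bar>ln b\<bar>" by linarith
  have "(ln x)\<^sup>2 - (ln y)\<^sup>2 - 2 * (ln y / y) * (x - y) = L\<^sup>2 + 2 * (ln y * (L - D))"
    by (simp add: L_def D_def power2_eq_square algebra_simps)
  also have "\<bar>\<dots>\<bar> \<le> L\<^sup>2 + 2 * (\<bar>ln y\<bar> * \<bar>L - D\<bar>)"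
    by (rule order_trans[OF abs_triangle_ineq]) (simp add: abs_mult)
  also have "\<dots> \<le> (x - y)\<^sup>2 / a\<^sup>2 + 2 * ((\<bar>ln a\<bar> + \<bar>ln b\<bar>) * ((x - y)\<^sup>2 / a\<^sup>2))"
    by (intro add_mono mult_left_mono mult_mono L2 ly LD) auto
  finally show ?thesis by (simp add: algebra_simps add_divide_distrib)
qed

lemma trace_udiag_mult:
  assumes U: "unitary U" and V: "unitary V"
  shows "Re (trace (udiag V a ** udiag U b)) = (\<Sum>i\<in>UNIV. \<Sum>k\<in>UNIV. coord V (column i U) k * (a k * b i))"
proof -
  have "Re (trace (udiag V a ** udiag U b)) = (\<Sum>i\<in>UNIV. column i U \<bullet> (udiag V a *v (udiag U b *v column i U)))"
    by (simp add: sum_quad_columns[OF U, symmetric] matrix_vector_mul_assoc)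
  then show ?thesis
    by (simp add: udiag_column U mat_vec_mult_scaleR quad_udiag sum_distrib_left mult_ac)
qed

text \<open>Half the gradient of \<open>log_norm2\<close>, as (ln t)^2 has derivative 2 ln t /
  t.\<close>

definition log_div :: "complex^'n^'n \<Rightarrow> complex^'n^'n" where
  "log_div = fun_calc (\<lambda>t. ln t / t)"

text \<open>In eigenbases \<open>(v\<^sub>k)\<close> of \<open>C\<close> and \<open>(u\<^sub>i)\<close> of \<open>D\<close> both sides are averages, with the weights
  \<open>\<bar>\<langle>v\<^sub>k, u\<^sub>i\<rangle>\<bar>\<^sup>2\<close>, of the two sides of the scalar Taylor estimate.\<close>

lemma log_norm2_taylor:
  assumes a: "0 < a" and C: "C \<in> spec_between a b" and D: "D \<in> spec_between a b"
  shows "\<bar>log_norm2 D - log_norm2 C - 2 * (log_div C \<bullet> (D - C))\<bar>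
    \<le> (1 + 2 * (\<bar>ln a\<bar> + \<bar>ln b\<bar>)) / a\<^sup>2 * (norm (D - C))\<^sup>2"
proof -
  obtain V e where V: "unitary V" "C = udiag V e" and e: "\<And>i. a \<le> e i" "\<And>i. e i \<le> b"
    using spec_between_cases[OF C] by blast
  obtain U d where U: "unitary U" "D = udiag U d" and d: "\<And>i. a \<le> d i" "\<And>i. d i \<le> b"
    using spec_between_cases[OF D] by blast
  define p where "p i k = coord V (column i U) k" for i k
  define M where "M = (1 + 2 * (\<bar>ln a\<bar> + \<bar>ln b\<bar>)) / a\<^sup>2"
  have p1: "(\<Sum>k\<in>UNIV. p i k) = 1" for i by (simp add: p_def sum_coord V norm_column U)
  have "p i k = coord U (column k V) i" for i k
    unfolding p_def by (metis coord_eq cdot_commute complex_mod_cnj)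
  then have p2: "(\<Sum>i\<in>UNIV. p i k) = 1" for k by (simp add: sum_coord U norm_column V)
  \<comment> \<open>The weights are doubly stochastic, so a sum over either spectrum alone is also a
    double sum with these weights, and everything can be compared term by term.\<close>
  have sum_d: "(\<Sum>i\<in>UNIV. f (d i)) = (\<Sum>i\<in>UNIV. \<Sum>k\<in>UNIV. p i k * f (d i))" for f :: "real \<Rightarrow> real"
    by (simp add: sum_distrib_right[symmetric] p1)
  have sum_e: "(\<Sum>k\<in>UNIV. f (e k)) = (\<Sum>i\<in>UNIV. \<Sum>k\<in>UNIV. p i k * f (e k))" for f :: "real \<Rightarrow> real"
    by (subst sum.swap) (simp add: sum_distrib_right[symmetric] p2)
  have F: "log_div C = udiag V (\<lambda>i. ln (e i) / e i)" by (simp add: log_div_def V fun_calc_udiag)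
  have e0: "e i \<noteq> 0" for i using e(1)[of i] a by auto
  have "log_div C \<bullet> (D - C) = Re (trace (log_div C ** D)) - Re (trace (log_div C ** C))"
    by (simp add: inner_matrix F hermitianD mat_mult_diff_left trace_sub)
  also have "\<dots> = (\<Sum>i\<in>UNIV. \<Sum>k\<in>UNIV. p i k * (ln (e k) / e k * d i)) - (\<Sum>i\<in>UNIV. \<Sum>k\<in>UNIV. p i k * ln (e k))"
    unfolding F unfolding U V trace_udiag_mult[OF U(1) V(1)] udiag_mult[OF V(1)] trace_udiag[OF V(1)] p_def[symmetric]
    using sum_e[of ln] e0 by simp
  also have "\<dots> = (\<Sum>i\<in>UNIV. \<Sum>k\<in>UNIV. p i k * (ln (e k) / e k * (d i - e k)))"
    using e0 by (simp add: sum_subtractf[symmetric] right_diff_distrib)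
  finally have FDC: "log_div C \<bullet> (D - C) = (\<Sum>i\<in>UNIV. \<Sum>k\<in>UNIV. p i k * (ln (e k) / e k * (d i - e k)))" .
  have "(norm (D - C))\<^sup>2 = (norm D)\<^sup>2 + (norm C)\<^sup>2 - 2 * (C \<bullet> D)"
    by (simp add: power2_norm_eq_inner inner_diff_left inner_diff_right inner_commute)
  also have "\<dots> = (\<Sum>i\<in>UNIV. \<Sum>k\<in>UNIV. p i k * (d i)\<^sup>2) + (\<Sum>i\<in>UNIV. \<Sum>k\<in>UNIV. p i k * (e k)\<^sup>2)
      - 2 * (\<Sum>i\<in>UNIV. \<Sum>k\<in>UNIV. p i k * (e k * d i))"
  proof -
    have "C \<bullet> D = (\<Sum>i\<in>UNIV. \<Sum>k\<in>UNIV. p i k * (e k * d i))"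
      unfolding inner_matrix V(2) hermitianD[OF hermitian_udiag] U(2) trace_udiag_mult[OF U(1) V(1)] p_def ..
    moreover have "(norm D)\<^sup>2 = (\<Sum>i\<in>UNIV. \<Sum>k\<in>UNIV. p i k * (d i)\<^sup>2)"
      using sum_d[of "\<lambda>t. t\<^sup>2"] by (simp add: U(2) norm_udiag U(1))
    moreover have "(norm C)\<^sup>2 = (\<Sum>i\<in>UNIV. \<Sum>k\<in>UNIV. p i k * (e k)\<^sup>2)"
      using sum_e[of "\<lambda>t. t\<^sup>2"] by (simp add: V(2) norm_udiag V(1))
    ultimately show ?thesis by simp
  qed
  also have "\<dots> = (\<Sum>i\<in>UNIV. \<Sum>k\<in>UNIV. p i k * (d i - e k)\<^sup>2)"
    unfolding sum_distrib_left sum.distrib[symmetric] sum_subtractf[symmetric]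
    by (intro sum.cong refl) (simp add: power2_eq_square algebra_simps)
  finally have NDC: "(norm (D - C))\<^sup>2 = (\<Sum>i\<in>UNIV. \<Sum>k\<in>UNIV. p i k * (d i - e k)\<^sup>2)" .
  have "log_norm2 D = (\<Sum>i\<in>UNIV. \<Sum>k\<in>UNIV. p i k * (ln (d i))\<^sup>2)"
    using sum_d[of "\<lambda>t. (ln t)\<^sup>2"] by (simp add: U(2) log_norm2_udiag U(1))
  moreover have "log_norm2 C = (\<Sum>i\<in>UNIV. \<Sum>k\<in>UNIV. p i k * (ln (e k))\<^sup>2)"
    using sum_e[of "\<lambda>t. (ln t)\<^sup>2"] by (simp add: V(2) log_norm2_udiag V(1))
  ultimately have "log_norm2 D - log_norm2 C - 2 * (log_div C \<bullet> (D - C)) =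
      (\<Sum>i\<in>UNIV. \<Sum>k\<in>UNIV. p i k * ((ln (d i))\<^sup>2 - (ln (e k))\<^sup>2 - 2 * (ln (e k) / e k) * (d i - e k)))"
    by (simp add: FDC sum_distrib_left sum_subtractf[symmetric] right_diff_distrib mult_ac)
  also have "\<bar>\<dots>\<bar> \<le> (\<Sum>i\<in>UNIV. \<Sum>k\<in>UNIV. p i k * (M * (d i - e k)\<^sup>2))"
  proof (intro order_trans[OF sum_abs] sum_mono)
    fix i k
    have "p i k * \<bar>(ln (d i))\<^sup>2 - (ln (e k))\<^sup>2 - 2 * (ln (e k) / e k) * (d i - e k)\<bar>
        \<le> p i k * (M * (d i - e k)\<^sup>2)"
      unfolding M_def by (intro mult_left_mono ln_square_taylor a d e) (simp add: p_def)
    then show "\<bar>p i k * ((ln (d i))\<^sup>2 - (ln (e k))\<^sup>2 - 2 * (ln (e k) / e k) * (d i - e k))\<bar>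
        \<le> p i k * (M * (d i - e k)\<^sup>2)"
      by (simp add: abs_mult p_def)
  qed
  also have "\<dots> = M * (norm (D - C))\<^sup>2"
    unfolding NDC sum_distrib_left by (simp add: mult.left_commute)
  finally show ?thesis by (simp add: M_def)
qed

text \<open>The derivative is taken relative to a set of Hermitian matrices, because the value of
  \<open>fun_calc\<close> at other matrices is unspecified.\<close>

lemma log_norm2_has_derivative:
  assumes a: "0 < a" and C: "C \<in> spec_between a b"
  shows "(log_norm2 has_derivative (\<lambda>E. 2 * (log_div C \<bullet> E))) (at C within spec_between a b)"
  unfolding has_derivative_within
proof
  show "bounded_linear (\<lambda>E. 2 * (log_div C \<bullet> E))"
    by (intro bounded_linear_const_mult bounded_linear_inner_right)
  define M where "M = (1 + 2 * (\<bar>ln a\<bar> + \<bar>ln b\<bar>)) / a\<^sup>2"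
  have "((\<lambda>D. M * norm (D - C)) \<longlongrightarrow> M * norm (C - C)) (at C within spec_between a b)"
    by (intro tendsto_intros)
  then have lim: "((\<lambda>D. M * norm (D - C)) \<longlongrightarrow> 0) (at C within spec_between a b)" by simp
  have "norm ((1 / norm (D - C)) *\<^sub>R (log_norm2 D - (log_norm2 C + 2 * (log_div C \<bullet> (D - C))))) \<le> M * norm (D - C)"
    if "D \<in> spec_between a b" for D
  proof (cases "D = C")
    case False
    have "\<bar>log_norm2 D - (log_norm2 C + 2 * (log_div C \<bullet> (D - C)))\<bar> \<le> M * (norm (D - C))\<^sup>2"
      using log_norm2_taylor[OF a C that] by (simp add: M_def diff_diff_eq)
    then show ?thesis using False by (simp add: field_simps power2_eq_square)
  qed simp
  then have "eventually (\<lambda>D. norm ((1 / norm (D - C)) *\<^sub>R (log_norm2 D - (log_norm2 C + 2 * (log_div C \<bullet> (D - C)))))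
      \<le> M * norm (D - C)) (at C within spec_between a b)"
    by (auto simp: eventually_at_filter)
  then show "((\<lambda>D. (1 / norm (D - C)) *\<^sub>R (log_norm2 D - (log_norm2 C + 2 * (log_div C \<bullet> (D - C))))) \<longlongrightarrow> 0)
      (at C within spec_between a b)"
    by (rule Lim_null_comparison[OF _ lim])
qed

lemma continuous_on_log_norm2: "0 < a \<Longrightarrow> continuous_on (spec_between a b) log_norm2"
  by (rule has_derivative_continuous_on[OF log_norm2_has_derivative])

section \<open>The Cartan mean solves the Karcher equation\<close>

lemma arg_min_minimizes:
  fixes f :: "'a \<Rightarrow> real"
  assumes "P x" "\<And>y. P y \<Longrightarrow> f x \<le> f y"
  shows "P (arg_min f P)" "\<And>y. P y \<Longrightarrow> f (arg_min f P) \<le> f y"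
proof -
  have "is_arg_min f P x" using assms by (auto simp: is_arg_min_def not_less)
  then have "is_arg_min f P (arg_min f P)" unfolding arg_min_def by (rule someI)
  then show "P (arg_min f P)" "\<And>y. P y \<Longrightarrow> f (arg_min f P) \<le> f y"
    by (auto simp: is_arg_min_def not_less)
qed

text \<open>The objective of the Cartan mean at X = Y^(-2).\<close>

definition cartan_objective :: "'j set \<Rightarrow> ('j \<Rightarrow> real) \<Rightarrow> ('j \<Rightarrow> complex^'n^'n) \<Rightarrow> complex^'n^'n \<Rightarrow> real" where
  "cartan_objective J w A Y = (\<Sum>j\<in>J. w j * log_norm2 (Y ** A j ** Y))"

lemma continuous_on_log_norm2_congruence:
  assumes "posdef A" "0 < \<alpha>"
  shows "continuous_on (spec_between \<alpha> \<beta>) (\<lambda>Y. log_norm2 (Y ** A ** Y))"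
proof -
  obtain a b where a: "0 < a" "a \<le> b" "A \<in> spec_between a b" using posdef_spec_between[OF assms(1)] by blast
  have "(\<lambda>Y. Y ** A ** Y) ` spec_between \<alpha> \<beta> \<subseteq> spec_between (a * \<alpha>\<^sup>2) (b * \<beta>\<^sup>2)"
    using assms a by (auto intro!: spec_between_congruence)
  then show ?thesis
    by (intro continuous_on_compose2[OF continuous_on_log_norm2 _ ] continuous_intros)
      (use a assms in auto)
qed

text \<open>Coercivity. The hypothesis confines the spectrum of Y A Y to an interval around 1; at a
  unit eigenvector v of Y with eigenvalue d its form is d^2 times that of A, which lies between
  \<open>a\<close> and \<open>b\<close>. This bounds d on both sides.\<close>

lemma log_norm2_congruence_bounded:
  assumes A: "posdef A"
  obtains \<alpha> \<beta> where "0 < \<alpha>"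
    "\<And>Y. posdef Y \<Longrightarrow> log_norm2 (Y ** A ** Y) \<le> r\<^sup>2 \<Longrightarrow> Y \<in> spec_between \<alpha> \<beta>"
proof -
  obtain a b where a: "0 < a" "a \<le> b" "A \<in> spec_between a b" using posdef_spec_between[OF A] by blast
  have b: "0 < b" using a by linarith
  show thesis
  proof (rule that[of "sqrt (exp (-\<bar>r\<bar>) / b)" "sqrt (exp \<bar>r\<bar> / a)"])
    show "0 < sqrt (exp (-\<bar>r\<bar>) / b)" using b by simp
    fix Y assume Y: "posdef Y" and le: "log_norm2 (Y ** A ** Y) \<le> r\<^sup>2"
    obtain U m where U: "unitary U" "Y ** A ** Y = udiag U m" and m: "\<And>i. 0 < m i"
      using posdef_cases[OF posdef_congruence[OF Y A]] by blast
    have "exp (-\<bar>r\<bar>) \<le> m i \<and> m i \<le> exp \<bar>r\<bar>" for i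
    proof -
      have "(ln (m i))\<^sup>2 \<le> (\<Sum>i\<in>UNIV. (ln (m i))\<^sup>2)" by (rule member_le_sum) auto
      also have "\<dots> \<le> r\<^sup>2" using le by (simp add: U log_norm2_udiag)
      finally have "\<bar>ln (m i)\<bar> \<le> \<bar>r\<bar>" by (simp add: abs_le_square_iff)
      then have "-\<bar>r\<bar> \<le> ln (m i)" "ln (m i) \<le> \<bar>r\<bar>" by linarith+
      then show ?thesis using m[of i] by (metis exp_le_cancel_iff exp_ln)
    qed
    then have YAY: "Y ** A ** Y \<in> spec_between (exp (-\<bar>r\<bar>)) (exp \<bar>r\<bar>)"
      by (simp add: U udiag_spec_between)
    obtain V d where V: "unitary V" "Y = udiag V d" and d: "\<And>i. 0 < d i" using posdef_cases[OF Y] by blast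
    have "sqrt (exp (-\<bar>r\<bar>) / b) \<le> d i \<and> d i \<le> sqrt (exp \<bar>r\<bar> / a)" for i
    proof -
      define v where "v = column i V"
      have Yv: "Y *v v = d i *\<^sub>R v" and nv: "norm v = 1"
        by (simp_all add: V v_def udiag_column norm_column)
      have q: "v \<bullet> ((Y ** A ** Y) *v v) = (d i)\<^sup>2 * (v \<bullet> (A *v v))"
        by (simp add: quad_congruence posdef_hermitian Y Yv mat_vec_mult_scaleR power2_eq_square)
      have "exp (-\<bar>r\<bar>) \<le> (d i)\<^sup>2 * (v \<bullet> (A *v v))" "(d i)\<^sup>2 * (v \<bullet> (A *v v)) \<le> exp \<bar>r\<bar>"
        unfolding q[symmetric] using YAY nv by (auto simp: spec_between_def dest: spec[of _ v])
      moreover have "a \<le> v \<bullet> (A *v v)" "v \<bullet> (A *v v) \<le> b"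
        using a(3) nv by (auto simp: spec_between_def dest: spec[of _ v])
      then have "(d i)\<^sup>2 * a \<le> (d i)\<^sup>2 * (v \<bullet> (A *v v))" "(d i)\<^sup>2 * (v \<bullet> (A *v v)) \<le> (d i)\<^sup>2 * b"
        by (auto intro!: mult_left_mono)
      ultimately have "exp (-\<bar>r\<bar>) / b \<le> (d i)\<^sup>2" "(d i)\<^sup>2 \<le> exp \<bar>r\<bar> / a"
        using a b by (simp_all add: field_simps)
      then show ?thesis using d[of i] by (auto intro: real_le_lsqrt real_le_rsqrt)
    qed
    then show "Y \<in> spec_between (sqrt (exp (-\<bar>r\<bar>) / b)) (sqrt (exp \<bar>r\<bar> / a))"
      by (simp add: V udiag_spec_between)
  qed
qed

lemma mat_1_spec_between: "mat 1 \<in> spec_between a b" if "a \<le> 1" "1 \<le> b"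
  using mult_right_mono[OF that(1)] mult_right_mono[OF that(2)]
  by (simp add: spec_between_def hermitian_def power2_norm_eq_inner)

lemma posdef_mat_1: "posdef (mat 1)"
  by (rule spec_between_posdef[OF mat_1_spec_between[of 1 1]]) auto

text \<open>A single index of positive weight already gives coercivity: any Z at least as good as
  the identity has its k-th term bounded by the value at the identity, which determines
  \<open>r\<close>.\<close>

lemma cartan_objective_attains_min:
  fixes A :: "'j \<Rightarrow> complex^'n^'n"
  assumes fin: "finite J" and A: "\<And>j. j \<in> J \<Longrightarrow> posdef (A j)" and w: "\<And>j. j \<in> J \<Longrightarrow> 0 \<le> w j" "sum w J = 1"
  obtains Y where "posdef Y" "\<And>Z. posdef Z \<Longrightarrow> cartan_objective J w A Y \<le> cartan_objective J w A Z"
proof -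
  let ?h = "cartan_objective J w A"
  obtain k where k: "k \<in> J" "w k \<noteq> 0" using w(2) by (metis sum.neutral zero_neq_one)
  then have "0 < w k" using w(1)[of k] by simp
  note k = k(1) this
  have h0: "0 \<le> w j * log_norm2 (Z ** A j ** Z)" if "j \<in> J" for j Z
    using w(1)[OF that] by (simp add: log_norm2_def)
  define r where "r = sqrt (?h (mat 1) / w k)"
  have "0 \<le> ?h (mat 1)" unfolding cartan_objective_def by (intro sum_nonneg h0)
  then have r2: "r\<^sup>2 = ?h (mat 1) / w k"
    unfolding r_def using k by simp
  obtain \<alpha> \<beta> where \<alpha>: "0 < \<alpha>" and
    bnd: "\<And>Y. posdef Y \<Longrightarrow> log_norm2 (Y ** A k ** Y) \<le> r\<^sup>2 \<Longrightarrow> Y \<in> spec_between \<alpha> \<beta>"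
    using log_norm2_congruence_bounded[OF A[OF k(1)]] by metis
  \<comment> \<open>Widened to contain the identity, which settles the competitors that are worse
    than it.\<close>
  define K :: "(complex^'n^'n) set" where "K = spec_between (min \<alpha> 1) (max \<beta> 1)"
  have "continuous_on K ?h" unfolding cartan_objective_def K_def
    using \<alpha> by (intro continuous_intros continuous_on_log_norm2_congruence A) auto
  moreover have one: "mat 1 \<in> K" by (simp add: K_def mat_1_spec_between)
  moreover have "compact K" by (simp add: K_def compact_spec_between)
  ultimately obtain Y where Y: "Y \<in> K" "\<And>Z. Z \<in> K \<Longrightarrow> ?h Y \<le> ?h Z"
    using continuous_attains_inf[of K ?h] by blast
  show thesis
  proof (rule that)
    show "posdef Y" using spec_between_posdef[OF Y(1)[unfolded K_def]] \<alpha> by simp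
    fix Z :: "complex^'n^'n" assume Z: "posdef Z"
    show "?h Y \<le> ?h Z"
    proof (cases "?h Z \<le> ?h (mat 1)")
      case True
      have "w k * log_norm2 (Z ** A k ** Z) \<le> ?h Z"
        unfolding cartan_objective_def by (rule member_le_sum[OF k(1)]) (auto simp: h0 fin)
      then have "log_norm2 (Z ** A k ** Z) \<le> r\<^sup>2" using True k by (simp add: r2 field_simps)
      then have "Z \<in> spec_between \<alpha> \<beta>" by (rule bnd[OF Z])
      then have "Z \<in> K" unfolding K_def by (rule spec_between_mono) auto
      then show ?thesis by (rule Y)
    next
      case False
      then show ?thesis using Y(2)[OF one] by linarith
    qed
  qed
qed

section \<open>First variation of the Cartan objective\<close>

lemma spec_between_add_scaleR:
  assumes C: "C \<in> spec_between \<alpha> \<beta>" and H: "H \<in> spec_between (-l) l" and t: "\<bar>t\<bar> * l \<le> \<epsilon>" and l: "0 \<le> l"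
  shows "C + t *\<^sub>R H \<in> spec_between (\<alpha> - \<epsilon>) (\<beta> + \<epsilon>)"
proof -
  have "(\<alpha> - \<epsilon>) * (norm x)\<^sup>2 \<le> x \<bullet> ((C + t *\<^sub>R H) *v x) \<and> x \<bullet> ((C + t *\<^sub>R H) *v x) \<le> (\<beta> + \<epsilon>) * (norm x)\<^sup>2" for x
  proof -
    have "\<bar>x \<bullet> (H *v x)\<bar> \<le> l * (norm x)\<^sup>2" using H by (auto simp: spec_between_def abs_le_iff minus_le_iff)
    then have "\<bar>t * (x \<bullet> (H *v x))\<bar> \<le> \<bar>t\<bar> * (l * (norm x)\<^sup>2)" by (simp add: abs_mult mult_left_mono)
    also have "\<dots> \<le> \<epsilon> * (norm x)\<^sup>2" using t by (simp add: mult.assoc[symmetric] mult_right_mono)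
    finally have "\<bar>t * (x \<bullet> (H *v x))\<bar> \<le> \<epsilon> * (norm x)\<^sup>2" .
    moreover have "\<alpha> * (norm x)\<^sup>2 \<le> x \<bullet> (C *v x)" "x \<bullet> (C *v x) \<le> \<beta> * (norm x)\<^sup>2"
      using C by (auto simp: spec_between_def)
    ultimately show ?thesis
      by (simp add: matrix_vector_mult_add_rdistrib mat_mult_vec_scaleR inner_add_right algebra_simps abs_le_iff)
  qed
  then show ?thesis using C H
    by (simp add: spec_between_def hermitian_def ctranspose_add ctranspose_scaleR)
qed

lemma posdef_perturbation:
  assumes "posdef Y" "hermitian H"
  obtains \<epsilon> \<alpha> \<beta> where "0 < \<epsilon>" "0 < \<alpha>" "\<And>t. \<bar>t\<bar> < \<epsilon> \<Longrightarrow> Y + t *\<^sub>R H \<in> spec_between \<alpha> \<beta>"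
proof -
  obtain a b where a: "0 < a" "a \<le> b" "Y \<in> spec_between a b" using posdef_spec_between[OF assms(1)] by blast
  obtain l where l: "0 \<le> l" "H \<in> spec_between (-l) l" using hermitian_spec_between[OF assms(2)] by blast
  show thesis
  \<comment> \<open>Such t move the spectrum by at most a / 2, half of the lower bound; l + 1 avoids
    dividing by zero.\<close>
  proof (rule that[of "a / (2 * (l + 1))" "a - a / 2" "b + a / 2"])
    fix t assume "\<bar>t\<bar> < a / (2 * (l + 1))"
    then have "\<bar>t\<bar> * l \<le> a / (2 * (l + 1)) * (l + 1)" using l by (intro mult_mono) auto
    also have "\<dots> = a / 2" using l by (simp add: field_simps)
    finally show "Y + t *\<^sub>R H \<in> spec_between (a - a / 2) (b + a / 2)"
      by (rule spec_between_add_scaleR[OF a(3) l(2) _ l(1)])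
  qed (use a l in auto)
qed

lemma trace_cycle3: "Re (trace (A ** B ** C)) = Re (trace (C ** A ** B))" for A B C :: "complex^'n^'n"
  using trace_mul_sym[of "A ** B" C] by (simp add: matrix_mul_assoc)

lemma trace_ctranspose: "Re (trace (ctranspose A)) = Re (trace A)"
  by (simp add: trace_def)

text \<open>The curve has velocity H A Y + Y A H. With B = Y A Y and W = Y^(-1) one has A Y = W B
  and Y A = B W, and multiplying the gradient by B turns it into log B. Cyclicity and conjugation of
  the trace make both halves equal.\<close>

lemma log_norm2_congruence_derivative:
  fixes Y A H :: "complex^'n^'n"
  assumes Y: "posdef Y" and A: "posdef A" and H: "hermitian H"
  shows "((\<lambda>t. log_norm2 ((Y + t *\<^sub>R H) ** A ** (Y + t *\<^sub>R H)))
    has_real_derivative 4 * (H \<bullet> (mat_powr Y (-1) ** mat_log (Y ** A ** Y)))) (at 0)"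
proof -
  obtain \<epsilon> \<alpha> \<beta> where \<epsilon>: "0 < \<epsilon>" and \<alpha>: "0 < \<alpha>" and
    YH: "\<And>t. \<bar>t\<bar> < \<epsilon> \<Longrightarrow> Y + t *\<^sub>R H \<in> spec_between \<alpha> \<beta>"
    using posdef_perturbation[OF Y H] by blast
  obtain a b where a: "0 < a" "a \<le> b" "A \<in> spec_between a b" using posdef_spec_between[OF A] by blast
  \<comment> \<open>On this open interval the curve stays in the set where the derivative of
    \<open>log_norm2\<close> is available; being open, it gives a two-sided derivative at 0.\<close>
  define S where "S = {-\<epsilon><..<\<epsilon>}"
  define c where "c t = (Y + t *\<^sub>R H) ** A ** (Y + t *\<^sub>R H)" for t
  define E1 E2 where "E1 = H ** A ** Y + Y ** A ** H" and "E2 = H ** A ** H"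
  define B where "B = Y ** A ** Y"
  have c_eq: "c = (\<lambda>t. B + t *\<^sub>R E1 + (t * t) *\<^sub>R E2)"
    by (rule ext) (simp add: c_def B_def E1_def E2_def mat_distribs scaleR_add_right)
  have c0: "c 0 = B" by (simp add: c_eq)
  have cS: "c ` S \<subseteq> spec_between (a * \<alpha>\<^sup>2) (b * \<beta>\<^sup>2)"
    unfolding c_def S_def using YH a \<alpha> by (auto intro!: spec_between_congruence simp: abs_less_iff)
  have "(c has_derivative (\<lambda>t. t *\<^sub>R E1)) (at 0 within S)"
    unfolding c_eq by (auto intro!: derivative_eq_intros)
  moreover have "B \<in> spec_between (a * \<alpha>\<^sup>2) (b * \<beta>\<^sup>2)"
    using cS \<epsilon> c0 by (auto simp: S_def image_subset_iff)
  then have "(log_norm2 has_derivative (\<lambda>E. 2 * (log_div B \<bullet> E))) (at (c 0) within (c ` S))"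
    unfolding c0 by (rule has_derivative_subset[OF log_norm2_has_derivative cS, rotated]) (use a \<alpha> in auto)
  ultimately have "((\<lambda>t. log_norm2 (c t)) has_derivative (\<lambda>t. 2 * (log_div B \<bullet> (t *\<^sub>R E1)))) (at 0 within S)"
    by (rule has_derivative_in_compose)
  then have der: "((\<lambda>t. log_norm2 (c t)) has_real_derivative 2 * (log_div B \<bullet> E1)) (at 0)"
    using \<epsilon> by (simp add: S_def at_within_open[of 0 "{-\<epsilon><..<\<epsilon>}"] has_field_derivative_def
        mult.left_commute[of 2] mult_commute_abs)
  have B: "posdef B" unfolding B_def by (rule posdef_congruence[OF Y A])
  define W F where "W = mat_powr Y (-1)" and "F = log_div B"
  have YW: "Y ** W = mat 1" "W ** Y = mat 1"
    unfolding W_def by (rule mat_powr_inverse[OF Y])+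
  obtain U d where U: "unitary U" "B = udiag U d" and d: "\<And>i. 0 < d i" using posdef_cases[OF B] by blast
  have d0: "d i \<noteq> 0" for i using d[of i] by simp
  have FB: "F ** B = mat_log B" "B ** F = mat_log B" and F: "hermitian F"
    using d0 by (simp_all add: F_def log_div_def U fun_calc_udiag udiag_mult mat_log_udiag)
  have hW: "ctranspose W = W" by (simp add: W_def hermitianD posdef_hermitian posdef_mat_powr Y)
  have hH: "ctranspose H = H" by (rule hermitianD[OF H])
  have hL: "ctranspose (mat_log B) = mat_log B" by (rule hermitianD[OF hermitian_mat_log[OF B]])
  have "W ** B = (W ** Y) ** A ** Y" "B ** W = Y ** A ** (Y ** W)"
    by (simp_all add: B_def matrix_mul_assoc)
  then have AY: "A ** Y = W ** B" "Y ** A = B ** W" by (simp_all add: YW)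
  have "E1 = H ** (A ** Y) + (Y ** A) ** H" by (simp add: E1_def matrix_mul_assoc)
  then have E1: "E1 = H ** W ** B + B ** W ** H" by (simp only: AY matrix_mul_assoc)
  have "F \<bullet> E1 = Re (trace (F ** (H ** W) ** B)) + Re (trace (F ** B ** (W ** H)))"
    by (simp add: inner_matrix hermitianD F E1 matrix_add_ldistrib trace_add matrix_mul_assoc)
  also have "Re (trace (F ** (H ** W) ** B)) = Re (trace (mat_log B ** (H ** W)))"
    by (subst trace_cycle3) (simp add: FB)
  also have "\<dots> = H \<bullet> (W ** mat_log B)"
    by (subst trace_mul_sym) (simp add: inner_matrix hH matrix_mul_assoc)
  also have "Re (trace (F ** B ** (W ** H))) = H \<bullet> (W ** mat_log B)"
    using trace_ctranspose[of "mat_log B ** (W ** H)"]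
    by (simp add: FB inner_matrix ctranspose_mult hH hL hW matrix_mul_assoc)
  finally have "2 * (log_div B \<bullet> E1) = 4 * (H \<bullet> (W ** mat_log B))" by (simp add: F_def)
  then show ?thesis using der by (simp only: W_def c_def B_def)
qed

text \<open>The direction of variation is the Karcher sum H itself. The derivative is then 4 tr(H
  Y^(-1) H), which is positive unless H = 0.\<close>

lemma cartan_objective_minimizer_stationary:
  fixes A :: "'j \<Rightarrow> complex^'n^'n"
  assumes fin: "finite J" and A: "\<And>j. j \<in> J \<Longrightarrow> posdef (A j)"
    and Y: "posdef Y" and min: "\<And>Z. posdef Z \<Longrightarrow> cartan_objective J w A Y \<le> cartan_objective J w A Z"
  shows "(\<Sum>j\<in>J. w j *\<^sub>R mat_log (Y ** A j ** Y)) = 0"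
proof (rule ccontr)
  define H where "H = (\<Sum>j\<in>J. w j *\<^sub>R mat_log (Y ** A j ** Y))"
  assume "(\<Sum>j\<in>J. w j *\<^sub>R mat_log (Y ** A j ** Y)) \<noteq> 0"
  then have H0: "H \<noteq> 0" by (simp add: H_def)
  have H: "hermitian H" unfolding hermitian_def H_def ctranspose_sum ctranspose_scaleR
    by (intro sum.cong refl) (simp add: hermitianD hermitian_mat_log posdef_congruence Y A)
  define W where "W = mat_powr Y (-1)"
  define h where "h t = cartan_objective J w A (Y + t *\<^sub>R H)" for t
  obtain \<epsilon> \<alpha> \<beta> where \<epsilon>: "0 < \<epsilon>" and \<alpha>: "0 < \<alpha>" and
    YH: "\<And>t. \<bar>t\<bar> < \<epsilon> \<Longrightarrow> Y + t *\<^sub>R H \<in> spec_between \<alpha> \<beta>"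
    using posdef_perturbation[OF Y H] by blast
  have "(h has_real_derivative (\<Sum>j\<in>J. w j * (4 * (H \<bullet> (W ** mat_log (Y ** A j ** Y)))))) (at 0)"
    unfolding h_def cartan_objective_def W_def
    by (intro DERIV_sum DERIV_cmult log_norm2_congruence_derivative Y A H)
  also have "(\<Sum>j\<in>J. w j * (4 * (H \<bullet> (W ** mat_log (Y ** A j ** Y))))) = 4 * (H \<bullet> (W ** H))"
    by (simp add: H_def[of] mat_mult_sum_left mat_mult_scaleR_right inner_sum_right sum_distrib_left mult.left_commute)
  finally have "4 * (H \<bullet> (W ** H)) = 0"
  proof (rule DERIV_local_min[OF _ \<epsilon>], intro allI impI)
    fix t :: real assume "\<bar>0 - t\<bar> < \<epsilon>"
    then have "posdef (Y + t *\<^sub>R H)" using spec_between_posdef[OF YH \<alpha>] by simp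
    then show "h 0 \<le> h t" using min by (simp add: h_def)
  qed
  then show False using inner_posdef_mult_pos[of W H] H0 by (simp add: W_def posdef_mat_powr Y)
qed

lemma mat_powr_powr: "posdef A \<Longrightarrow> mat_powr (mat_powr A p) q = mat_powr A (p * q)"
  by (elim posdef_cases) (simp add: mat_powr_udiag powr_powr)

theorem cartan_mean_karcher:
  fixes A :: "nat \<Rightarrow> complex^'n^'n" and w :: "nat \<Rightarrow> real"
  assumes A: "\<And>j. j \<in> {1..m} \<Longrightarrow> posdef (A j)" and w: "\<And>j. j \<in> {1..m} \<Longrightarrow> 0 \<le> w j" "(\<Sum>j = 1..m. w j) = 1"
  defines "G \<equiv> cartan_mean m w A"
  shows "posdef G" "(\<Sum>j = 1..m. w j *\<^sub>R mat_log (mat_powr G (-1/2) ** A j ** mat_powr G (-1/2))) = 0"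
proof -
  let ?h = "cartan_objective {1..m} w A"
  have obj: "(\<Sum>j = 1..m. w j * (cartan_dist X (A j))\<^sup>2) = ?h (mat_powr X (-1/2))" for X
    by (simp add: cartan_objective_def cartan_dist_def frob_norm_eq log_norm2_def)
  obtain Y where Y: "posdef Y" "\<And>Z. posdef Z \<Longrightarrow> ?h Y \<le> ?h Z"
    using cartan_objective_attains_min[of "{1..m}" A w, OF _ A w] by blast
  \<comment> \<open>X = Y^(-2) inverts Y = X^(-1/2) on positive definite matrices, so minimizers in
    the two variables correspond.\<close>
  have "posdef (mat_powr Y (-2))" "mat_powr (mat_powr Y (-2)) (-1/2) = Y"
    using Y(1) by (simp_all add: posdef_mat_powr mat_powr_powr mat_powr_one)
  then have "(\<Sum>j = 1..m. w j * (cartan_dist (mat_powr Y (-2)) (A j))\<^sup>2) \<le>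
      (\<Sum>j = 1..m. w j * (cartan_dist X (A j))\<^sup>2)" if "posdef X" for X
    unfolding obj using Y(2) posdef_mat_powr[OF that] by metis
  then have G: "posdef G" and min: "\<And>X. posdef X \<Longrightarrow>
      (\<Sum>j = 1..m. w j * (cartan_dist G (A j))\<^sup>2) \<le> (\<Sum>j = 1..m. w j * (cartan_dist X (A j))\<^sup>2)"
    unfolding G_def cartan_mean_def
    using arg_min_minimizes[of posdef "mat_powr Y (-2)" "\<lambda>X. \<Sum>j = 1..m. w j * (cartan_dist X (A j))\<^sup>2"]
      \<open>posdef (mat_powr Y (-2))\<close> by blast+
  show "posdef G" by (rule G)
  have "?h (mat_powr G (-1/2)) \<le> ?h Z" if Z: "posdef Z" for Z
  proof -
    have "mat_powr (mat_powr Z (-2)) (-1/2) = Z" using Z by (simp add: mat_powr_powr mat_powr_one)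
    then show ?thesis using min[OF posdef_mat_powr[OF Z], of "-2"] unfolding obj by simp
  qed
  then show "(\<Sum>j = 1..m. w j *\<^sub>R mat_log (mat_powr G (-1/2) ** A j ** mat_powr G (-1/2))) = 0"
    by (intro cartan_objective_minimizer_stationary posdef_mat_powr G) (auto simp: A)
qed

section \<open>The Wasserstein mean solves the Riccati system\<close>

lemma inner_mult_left_ge:
  assumes "S \<in> spec_between s t"
  shows "s * (norm D)\<^sup>2 \<le> D \<bullet> (S ** D)"
proof -
  have "s * (norm D)\<^sup>2 = (\<Sum>j\<in>UNIV. s * (norm (column j D))\<^sup>2)"
    unfolding power2_norm_eq_inner inner_columns[of D D] sum_distrib_left ..
  also have "\<dots> \<le> D \<bullet> (S ** D)"
    unfolding inner_columns[of D "S ** D"] column_mult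
    using assms by (intro sum_mono) (simp add: spec_between_def)
  finally show ?thesis .
qed

text \<open>Pair D = S - T with S^2 - T^2 = S D + D T and use S, T >= s. It makes the square root
  Lipschitz on spectra bounded away from 0, hence continuous as Brouwer's theorem requires.\<close>

lemma norm_diff_le_norm_square_diff:
  assumes S: "S \<in> spec_between s t" and T: "T \<in> spec_between s t"
  shows "2 * s * norm (S - T) \<le> norm (S ** S - T ** T)"
proof (cases "S = T")
  case False
  define D where "D = S - T"
  have D: "ctranspose D = D" using S T by (simp add: D_def ctranspose_diff spec_between_def hermitian_def)
  have "D \<bullet> (D ** T) = D \<bullet> (T ** D)"
    by (simp add: inner_matrix D matrix_mul_assoc trace_cycle3[of D T D])
  moreover have "S ** S - T ** T = S ** D + D ** T"
    by (simp add: D_def mat_distribs)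
  ultimately have "2 * s * (norm D)\<^sup>2 \<le> D \<bullet> (S ** S - T ** T)"
    using inner_mult_left_ge[OF S, of D] inner_mult_left_ge[OF T, of D] by (simp add: inner_add_right)
  also have "\<dots> \<le> norm D * norm (S ** S - T ** T)" by (rule norm_cauchy_schwarz)
  finally show ?thesis using False by (simp add: D_def power2_eq_square)
qed simp

lemma mat_powr_half_spec_between:
  assumes "C \<in> spec_between a b" "0 < a"
  shows "mat_powr C (1/2) \<in> spec_between (sqrt a) (sqrt b)"
  using assms(1)
proof (rule spec_between_cases)
  fix U d assume U: "unitary U" "C = udiag U d" and d: "\<And>i. a \<le> d i" "\<And>i. d i \<le> b"
  have "0 \<le> d i" for i using d(1)[of i] assms(2) by linarith
  then show ?thesis using d by (simp add: U mat_powr_udiag udiag_spec_between powr_half_sqrt)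
qed

lemma continuous_on_mat_powr_half:
  assumes a: "0 < a"
  shows "continuous_on (spec_between a b) (\<lambda>C :: complex^'n^'n. mat_powr C (1/2))"
proof (rule lipschitz_on_continuous_on)
  show "(1 / (2 * sqrt a))-lipschitz_on (spec_between a b) (\<lambda>C :: complex^'n^'n. mat_powr C (1/2))"
  proof (rule lipschitz_onI)
    fix C D :: "complex^'n^'n" assume C: "C \<in> spec_between a b" and D: "D \<in> spec_between a b"
    then show "dist (mat_powr C (1/2)) (mat_powr D (1/2)) \<le> 1 / (2 * sqrt a) * dist C D"
      using norm_diff_le_norm_square_diff[OF mat_powr_half_spec_between[OF C a] mat_powr_half_spec_between[OF D a]] a
      by (simp add: mat_powr_half_square spec_between_posdef[OF _ a] dist_norm field_simps)
  qed (use a in simp)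
qed

lemma convex_spec_between: "convex (spec_between a b)"
proof (rule convexI)
  fix C D :: "complex^'n^'n" and u v :: real
  assume C: "C \<in> spec_between a b" and D: "D \<in> spec_between a b" and uv: "0 \<le> u" "0 \<le> v" "u + v = 1"
  have "a * (norm x)\<^sup>2 \<le> u * (x \<bullet> (C *v x)) + v * (x \<bullet> (D *v x)) \<and>
      u * (x \<bullet> (C *v x)) + v * (x \<bullet> (D *v x)) \<le> b * (norm x)\<^sup>2" for x
  proof -
    have C1: "a * (norm x)\<^sup>2 \<le> x \<bullet> (C *v x)" "x \<bullet> (C *v x) \<le> b * (norm x)\<^sup>2"
      and D1: "a * (norm x)\<^sup>2 \<le> x \<bullet> (D *v x)" "x \<bullet> (D *v x) \<le> b * (norm x)\<^sup>2"
      using C D by (auto simp: spec_between_def)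
    have "u * (a * (norm x)\<^sup>2) + v * (a * (norm x)\<^sup>2) \<le> u * (x \<bullet> (C *v x)) + v * (x \<bullet> (D *v x))"
      "u * (x \<bullet> (C *v x)) + v * (x \<bullet> (D *v x)) \<le> u * (b * (norm x)\<^sup>2) + v * (b * (norm x)\<^sup>2)"
      using uv C1 D1 by (auto intro!: add_mono mult_left_mono)
    then show ?thesis using uv by (simp add: distrib_right[symmetric])
  qed
  then show "u *\<^sub>R C + v *\<^sub>R D \<in> spec_between a b" using C D
    by (simp add: spec_between_def hermitian_def ctranspose_add ctranspose_scaleR
        matrix_vector_mult_add_rdistrib mat_mult_vec_scaleR inner_add_right)
qed

text \<open>If X and all A_j have spectrum in [\<alpha>, \<beta>], then X^(1/2) A_j X^(1/2) has
  spectrum in [\<alpha>^2, \<beta>^2] and its root is back in [\<alpha>, \<beta>]. A convex compact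
  set is thus mapped into itself.\<close>

lemma wasserstein_fixed_point:
  fixes A :: "'j \<Rightarrow> complex^'n^'n"
  assumes fin: "finite J" and A: "\<And>j. j \<in> J \<Longrightarrow> posdef (A j)" and w: "\<And>j. j \<in> J \<Longrightarrow> 0 \<le> w j" "sum w J = 1"
  obtains X where "posdef X"
    "(\<Sum>j\<in>J. w j *\<^sub>R mat_powr (mat_powr X (1/2) ** A j ** mat_powr X (1/2)) (1/2)) = X"
proof -
  define \<Phi> where "\<Phi> X = (\<Sum>j\<in>J. w j *\<^sub>R mat_powr (mat_powr X (1/2) ** A j ** mat_powr X (1/2)) (1/2))" for X
  have "\<forall>j\<in>J. \<exists>ab. 0 < fst ab \<and> A j \<in> spec_between (fst ab) (snd ab)"
    using posdef_spec_between[OF A] by (metis fst_conv snd_conv)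
  then obtain ab where ab: "\<And>j. j \<in> J \<Longrightarrow> 0 < fst (ab j)" "\<And>j. j \<in> J \<Longrightarrow> A j \<in> spec_between (fst (ab j)) (snd (ab j))"
    by metis
  \<comment> \<open>The inserted 1 puts the identity into \<open>K\<close>, which is therefore
    nonempty.\<close>
  define \<alpha> \<beta> where "\<alpha> = Min (insert 1 ((\<lambda>j. fst (ab j)) ` J))" and "\<beta> = Max (insert 1 ((\<lambda>j. snd (ab j)) ` J))"
  have \<alpha>: "0 < \<alpha>" and \<alpha>1: "\<alpha> \<le> 1" and \<beta>1: "1 \<le> \<beta>" using fin ab by (auto simp: \<alpha>_def \<beta>_def)
  have \<beta>: "0 < \<beta>" using \<beta>1 by linarith
  have AK: "A j \<in> spec_between \<alpha> \<beta>" if "j \<in> J" for j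
    using ab(2)[OF that] by (rule spec_between_mono) (use fin that in \<open>auto simp: \<alpha>_def \<beta>_def\<close>)
  define K :: "(complex^'n^'n) set" where "K = spec_between \<alpha> \<beta>"
  have inner: "mat_powr X (1/2) ** A j ** mat_powr X (1/2) \<in> spec_between (\<alpha> * \<alpha>) (\<beta> * \<beta>)"
    if "X \<in> K" "j \<in> J" for X j
    using spec_between_congruence[OF mat_powr_half_spec_between[OF that(1)[unfolded K_def] \<alpha>] _ AK[OF that(2)]] \<alpha> \<beta>
    by simp
  have "mat_powr (mat_powr X (1/2) ** A j ** mat_powr X (1/2)) (1/2) \<in> K" if "X \<in> K" "j \<in> J" for X j
    using mat_powr_half_spec_between[OF inner[OF that]] \<alpha> \<beta> by (simp add: K_def real_sqrt_mult)
  then have "\<Phi> \<in> K \<rightarrow> K" unfolding \<Phi>_def K_def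
    by (intro Pi_I convex_sum fin convex_spec_between w) auto
  moreover have "continuous_on K \<Phi>" unfolding \<Phi>_def
  proof (intro continuous_intros)
    fix j assume j: "j \<in> J"
    have "continuous_on K (\<lambda>X. mat_powr X (1/2) ** A j ** mat_powr X (1/2))"
      unfolding K_def by (intro continuous_intros continuous_on_mat_powr_half \<alpha>)
    then show "continuous_on K (\<lambda>X. mat_powr (mat_powr X (1/2) ** A j ** mat_powr X (1/2)) (1/2))"
      using inner[OF _ j] \<alpha>
      by (intro continuous_on_compose2[OF continuous_on_mat_powr_half[of "\<alpha> * \<alpha>" "\<beta> * \<beta>"]]) auto
  qed
  moreover have "mat 1 \<in> K" by (simp add: K_def mat_1_spec_between \<alpha>1 \<beta>1)
  ultimately obtain X where X: "X \<in> K" "\<Phi> X = X"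
    using brouwer[of K \<Phi>] compact_spec_between convex_spec_between unfolding K_def by blast
  then show thesis using that[of X] spec_between_posdef[of X \<alpha> \<beta>] \<alpha> by (simp add: K_def \<Phi>_def)
qed

lemma sum_riccati_eq_one:
  assumes X: "posdef X"
    and fp: "(\<Sum>j\<in>J. w j *\<^sub>R mat_powr (mat_powr X (1/2) ** A j ** mat_powr X (1/2)) (1/2)) = X"
  shows "(\<Sum>j\<in>J. w j *\<^sub>R riccati X (A j)) = mat 1"
proof -
  define R K where "R = mat_powr X (1/2)" and "K = mat_powr X (-1/2)"
  have RR: "R ** R = X" unfolding R_def by (rule mat_powr_half_square[OF X])
  have RK: "R ** K = mat 1" "K ** R = mat 1" unfolding R_def K_def by (rule mat_powr_half_inverse[OF X])+
  have "(\<Sum>j\<in>J. w j *\<^sub>R riccati X (A j)) = K ** (\<Sum>j\<in>J. w j *\<^sub>R mat_powr (R ** A j ** R) (1/2)) ** K"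
    by (simp add: riccati_def R_def K_def mat_mult_sum_left mat_mult_sum_right mat_mult_scaleR_left mat_mult_scaleR_right)
  also have "\<dots> = (K ** R) ** (R ** K)"
    using fp by (simp add: R_def[symmetric]) (simp add: RR[symmetric] matrix_mul_assoc)
  finally show ?thesis by (simp add: RK)
qed

text \<open>The slack in the duality bound 2 tr(X S) <= tr(X T) + tr(A T^(-1)) with S =
  \<open>riccati X A\<close>. Distributing X^(1/2) over both arguments exhibits it as a positive
  form.\<close>

definition riccati_gap :: "complex^'n^'n \<Rightarrow> complex^'n^'n \<Rightarrow> complex^'n^'n \<Rightarrow> real" where
  "riccati_gap X A T = ((riccati X A - T) ** mat_powr X (1/2)) \<bullet>
     (mat_powr T (-1) ** ((riccati X A - T) ** mat_powr X (1/2)))"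

lemma riccati_gap_nonneg: "posdef T \<Longrightarrow> 0 \<le> riccati_gap X A T"
  unfolding riccati_gap_def
  by (metis inner_posdef_mult_pos inner_zero_left less_imp_le order_refl posdef_mat_powr)

lemma riccati_gap_eq_0D:
  assumes T: "posdef T" and X: "posdef X" and "riccati_gap X A T = 0"
  shows "riccati X A = T"
proof -
  let ?D = "(riccati X A - T) ** mat_powr X (1/2)"
  have "?D = 0" using inner_posdef_mult_pos[OF posdef_mat_powr[OF T], of ?D "-1"] assms(3)
    by (auto simp: riccati_gap_def)
  then have "?D ** mat_powr X (-1/2) = 0" by simp
  moreover have "?D ** mat_powr X (-1/2) = riccati X A - T"
    by (simp only: matrix_mul_assoc[symmetric] mat_powr_half_inverse[OF X] matrix_mul_rid)
  ultimately show ?thesis by simp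
qed

text \<open>The expansion of the positive quantity \<open>tr X (S - T) T\<^sup>-\<^sup>1 (S - T)\<close> for \<open>S X S = A\<close>.\<close>

lemma riccati_gap_eq:
  assumes X: "posdef X" and A: "posdef A" and T: "posdef T"
  shows "riccati_gap X A T = X \<bullet> T + A \<bullet> mat_powr T (-1) - 2 * (X \<bullet> riccati X A)"
proof -
  define S T' R D where "S = riccati X A" and "T' = mat_powr T (-1)" and "R = mat_powr X (1/2)" and "D = S - T"
  have S: "ctranspose S = S" "S ** X ** S = A"
    using riccati[OF X A] by (auto simp: S_def posdef_hermitian hermitianD)
  have tT: "ctranspose T = T" and tR: "ctranspose R = R" and tX: "ctranspose X = X" and tA: "ctranspose A = A"
    using X A T by (auto simp: R_def posdef_hermitian hermitianD posdef_mat_powr)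
  have RR: "R ** R = X" by (simp add: R_def mat_powr_half_square X)
  have TT: "T ** T' = mat 1" "T' ** T = mat 1"
    unfolding T'_def by (rule mat_powr_inverse[OF T])+
  have "riccati_gap X A T = Re (trace (R ** (D ** T' ** D) ** R))"
    by (simp add: riccati_gap_def S_def[symmetric] T'_def[symmetric] R_def[symmetric] D_def[symmetric]
        inner_matrix ctranspose_mult tR matrix_mul_assoc) (simp add: D_def ctranspose_diff S tT)
  also have "\<dots> = Re (trace (X ** (D ** T' ** D)))"
    by (subst trace_cycle3) (simp add: RR)
  also have "D ** T' ** D = S ** T' ** S - S - S + T"
  proof -
    have "D ** T' ** D = S ** T' ** S - S ** (T' ** T) - (T ** T') ** S + (T ** T') ** T"
      by (simp add: D_def mat_mult_diff_left mat_mult_diff_right matrix_mul_assoc)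
    then show ?thesis by (simp add: TT)
  qed
  also have "Re (trace (X ** (S ** T' ** S - S - S + T))) = Re (trace (X ** (S ** T') ** S)) + X \<bullet> T - 2 * (X \<bullet> S)"
    by (simp only: inner_matrix tX mat_mult_diff_left matrix_add_ldistrib trace_add trace_sub matrix_mul_assoc) simp
  also have "Re (trace (X ** (S ** T') ** S)) = Re (trace ((S ** X ** S) ** T'))"
    by (subst trace_cycle3) (simp add: matrix_mul_assoc)
  finally show ?thesis unfolding S(2) by (simp add: inner_matrix tA T'_def S_def)
qed

text \<open>The radicand equals the gap at T = I. It is therefore nonnegative, and squaring really
  undoes the root.\<close>

lemma bw_dist_square:
  assumes X: "posdef X" and A: "posdef A"
  shows "(bw_dist X A)\<^sup>2 = Re (trace X) + Re (trace A) - 2 * (X \<bullet> riccati X A)"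
proof -
  define R K M where "R = mat_powr X (1/2)" and "K = mat_powr X (-1/2)" and "M = mat_powr (R ** A ** R) (1/2)"
  have RR: "R ** R = X" unfolding R_def by (rule mat_powr_half_square[OF X])
  have RK: "R ** K = mat 1" "K ** R = mat 1" unfolding R_def K_def by (rule mat_powr_half_inverse[OF X])+
  have ric: "riccati X A = K ** M ** K" by (simp add: riccati_def R_def K_def M_def)
  have "X \<bullet> riccati X A = Re (trace (R ** (R ** K ** M) ** K))"
    unfolding ric inner_matrix hermitianD[OF posdef_hermitian[OF X]] by (simp add: RR[symmetric] matrix_mul_assoc)
  also have "\<dots> = Re (trace M)" by (subst trace_cycle3) (simp add: RK)
  finally have tr: "Re (trace M) = X \<bullet> riccati X A" by simp
  have bw: "bw_dist X A = sqrt (Re (trace X) + Re (trace A) - 2 * (X \<bullet> riccati X A))"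
    unfolding bw_dist_def tr[symmetric] M_def R_def by (simp add: trace_add)
  have one: "mat_powr (mat 1) (-1) = (mat 1 :: complex^'n^'n)"
    using mat_powr_inverse(1)[OF posdef_mat_1] by simp
  have "0 \<le> riccati_gap X A (mat 1)" by (rule riccati_gap_nonneg[OF posdef_mat_1])
  then show ?thesis using X A
    by (simp add: bw riccati_gap_eq posdef_mat_1 one inner_matrix hermitianD posdef_hermitian)
qed

text \<open>Expanding each distance by means of the gap at the fixed T_j, the terms in tr X cancel
  because the T_j average to I. The objective is a constant plus a weighted sum of gaps, all zero at
  the fixed point \<open>X0\<close>. So every minimizer has zero gaps where the weight is positive,
  and T_k \<Omega> T_k = A_k = T_k X0 T_k identifies it with \<open>X0\<close>.\<close>

theorem wasserstein_mean_riccati: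
  fixes A :: "nat \<Rightarrow> complex^'n^'n" and w :: "nat \<Rightarrow> real"
  assumes A: "\<And>j. j \<in> {1..m} \<Longrightarrow> posdef (A j)" and w: "\<And>j. j \<in> {1..m} \<Longrightarrow> 0 \<le> w j" "(\<Sum>j = 1..m. w j) = 1"
  defines "\<Omega> \<equiv> wasserstein_mean m w A"
  shows "posdef \<Omega>" "(\<Sum>j = 1..m. w j *\<^sub>R riccati \<Omega> (A j)) = mat 1"
proof -
  obtain X0 where X0: "posdef X0"
    "(\<Sum>j = 1..m. w j *\<^sub>R mat_powr (mat_powr X0 (1/2) ** A j ** mat_powr X0 (1/2)) (1/2)) = X0"
    using wasserstein_fixed_point[of "{1..m}" A w, OF _ A w] by blast
  define T where "T j = riccati X0 (A j)" for j
  have T: "posdef (T j)" "T j ** X0 ** T j = A j" if "j \<in> {1..m}" for j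
    unfolding T_def using riccati[OF X0(1) A[OF that]] by auto
  have T1: "(\<Sum>j = 1..m. w j *\<^sub>R T j) = mat 1"
    unfolding T_def by (rule sum_riccati_eq_one[OF X0])
  define obj where "obj X = (\<Sum>j = 1..m. w j * (bw_dist X (A j))\<^sup>2)" for X
  define c where "c = (\<Sum>j = 1..m. w j * (Re (trace (A j)) - A j \<bullet> mat_powr (T j) (-1)))"
  have obj: "obj X = c + (\<Sum>j = 1..m. w j * riccati_gap X (A j) (T j))" if X: "posdef X" for X
  proof -
    have "obj X = (\<Sum>j = 1..m. w j * (Re (trace (A j)) - A j \<bullet> mat_powr (T j) (-1))
        + w j * riccati_gap X (A j) (T j) + (w j * Re (trace X) - X \<bullet> (w j *\<^sub>R T j)))"
      unfolding obj_def
      by (intro sum.cong refl) (simp add: bw_dist_square X A T riccati_gap_eq algebra_simps)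
    also have "\<dots> = c + (\<Sum>j = 1..m. w j * riccati_gap X (A j) (T j)) + (Re (trace X) - X \<bullet> mat 1)"
      unfolding sum.distrib sum_subtractf inner_sum_right[symmetric] T1 sum_distrib_right[symmetric] w c_def by simp
    also have "X \<bullet> mat 1 = Re (trace X)"
      by (simp add: inner_matrix hermitianD posdef_hermitian X)
    finally show ?thesis by simp
  qed
  have gap0: "0 \<le> w j * riccati_gap X (A j) (T j)" if "j \<in> {1..m}" for j X
    using w(1)[OF that] riccati_gap_nonneg[OF T(1)[OF that]] by simp
  have "riccati_gap X0 (A j) (T j) = 0" for j by (simp add: riccati_gap_def T_def)
  then have objX0: "obj X0 = c" by (simp add: obj X0)
  then have X0_min: "obj X0 \<le> obj X" if "posdef X" for X
    using sum_nonneg[OF gap0, of "{1..m}"] by (simp add: obj that)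
  then have \<Omega>: "posdef \<Omega>" and "obj \<Omega> \<le> obj X0"
    unfolding \<Omega>_def wasserstein_mean_def obj_def[symmetric]
    using arg_min_minimizes[of posdef X0 obj] X0(1) by blast+
  then have "(\<Sum>j = 1..m. w j * riccati_gap \<Omega> (A j) (T j)) \<le> 0" using objX0 by (simp add: obj)
  then have gap_sum: "(\<Sum>j = 1..m. w j * riccati_gap \<Omega> (A j) (T j)) = 0"
    using sum_nonneg[OF gap0, of "{1..m}"] by (simp add: order_antisym)
  have gap: "w j * riccati_gap \<Omega> (A j) (T j) = 0" if "j \<in> {1..m}" for j
    by (rule sum_nonneg_0[OF finite_atLeastAtMost gap0 gap_sum that])
  \<comment> \<open>Weights may vanish, and only an index of nonzero weight forces its gap to be 0;
    one such index is enough.\<close>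
  obtain k where k: "k \<in> {1..m}" "w k \<noteq> 0" using w(2) by (metis sum.neutral zero_neq_one)
  then have "riccati \<Omega> (A k) = T k"
    using gap[OF k(1)] by (intro riccati_gap_eq_0D T \<Omega>) simp_all
  then have "T k ** \<Omega> ** T k = T k ** X0 ** T k"
    using riccati(2)[OF \<Omega> A[OF k(1)]] T(2)[OF k(1)] by simp
  then have "mat_powr (T k) (-1) ** (T k ** \<Omega> ** T k) ** mat_powr (T k) (-1)
      = mat_powr (T k) (-1) ** (T k ** X0 ** T k) ** mat_powr (T k) (-1)" by simp
  moreover have "mat_powr (T k) (-1) ** (T k ** X ** T k) ** mat_powr (T k) (-1) = X" for X
  proof -
    have TT: "T k ** mat_powr (T k) (-1) = mat 1" "mat_powr (T k) (-1) ** T k = mat 1"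
      using mat_powr_inverse[OF T(1)[OF k(1)]] by blast+
    have "mat_powr (T k) (-1) ** (T k ** X ** T k) ** mat_powr (T k) (-1)
        = (mat_powr (T k) (-1) ** T k) ** X ** (T k ** mat_powr (T k) (-1))"
      by (simp only: matrix_mul_assoc)
    then show ?thesis by (simp only: TT matrix_mul_lid matrix_mul_rid)
  qed
  ultimately have "\<Omega> = X0" by simp
  then show "posdef \<Omega>" "(\<Sum>j = 1..m. w j *\<^sub>R riccati \<Omega> (A j)) = mat 1"
    using \<Omega> T1 by (simp_all add: T_def)
qed

theorem theorem1:
  fixes A :: "nat \<Rightarrow> complex^'n^'n" and w :: "nat \<Rightarrow> real" and m :: nat
  assumes "\<And>j. j \<in> {1..m} \<Longrightarrow> posdef (A j)"
    and "\<And>j. j \<in> {1..m} \<Longrightarrow> 0 \<le> w j"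
    and "(\<Sum>j = 1..m. w j) = 1"
  shows "eigvals (cartan_mean m w A) \<prec>log eigvals (log_euclidean_mean m w A) \<and>
         eigvals (log_euclidean_mean m w A) \<prec>wlog eigvals (wasserstein_mean m w A)"
proof
  show "eigvals (cartan_mean m w A) \<prec>log eigvals (log_euclidean_mean m w A)"
    unfolding log_euclidean_mean_def
    using cartan_mean_karcher[of m A w, OF assms] by (intro log_majorized_of_karcher assms) simp_all
  show "eigvals (log_euclidean_mean m w A) \<prec>wlog eigvals (wasserstein_mean m w A)"
    unfolding log_euclidean_mean_def
    using wasserstein_mean_riccati[of m A w, OF assms] assms
    by (intro wlog_majorized_of_riccati[where T = "\<lambda>j. riccati (wasserstein_mean m w A) (A j)"] riccati) simp_all
qed

end
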